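(* Let $G$ be a subcubic planar graph with girth $g$. 1. If $g\geq 16$, then $\chi'_{\mathrm{inj}}(G)\leq 4$. 2. If $g\geq 10$, then $\chi'_{\mathrm{inj}}(G)\leq 5$ (due to Bu and Qi). 3. If $g\geq 8$, then $\chi'_{\mathrm{inj}}(G)\leq 6$. 4. If $g\geq 6$, then $\chi'_{\mathrm{inj}}(G)\leq 7$.
   Context: All graphs are finite and simple. A graph is subcubic if its maximum degree is at most $3$. The girth of a graph is the length of a shortest cycle contained in it. Three edges $e_1,e_2,e_3$ of a graph are consecutive if they form (in this order) a path of length three or a cycle of length three. An injective edge-coloring of $G$ with $k$ colors is a map $c:E(G)\to\{1,\dots,k\}$ (not necessarily a proper edge-coloring) such that $c(e_1)\neq c(e_3)$ whenever $e_1,e_2,e_3$ are consecutive edges in $G$. The injective chromatic index $\chi'_{\mathrm{inj}}(G)$ is the minimum $k$ such that $G$ has an injective edge-coloring with $k$ colors. *)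

theory Defs
  imports "HOL-Analysis.Analysis"
begin

definition simple_graph :: "'a set \<Rightarrow> 'a set set \<Rightarrow> bool" where
  "simple_graph V E \<longleftrightarrow> finite V \<and> (\<forall>e\<in>E. e \<subseteq> V \<and> card e = 2)"

definition degree :: "'a set set \<Rightarrow> 'a \<Rightarrow> nat" where
  "degree E v = card {e \<in> E. v \<in> e}"

definition subcubic :: "'a set \<Rightarrow> 'a set set \<Rightarrow> bool" where
  "subcubic V E \<longleftrightarrow> (\<forall>v\<in>V. degree E v \<le> 3)"

text \<open>A graph is planar if it can be drawn in the plane (here \<^typ>\<open>complex\<close>): vertices go to distinct
  points, edges to arcs (injective continuous paths, not necessarily polygonal) joining their
  endpoints and avoiding all other vertices, and two arcs meet only in common endpoints.\<close>

definition planar :: "'a set \<Rightarrow> 'a set set \<Rightarrow> bool" where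
  "planar V E \<longleftrightarrow>
     (\<exists>(p :: 'a \<Rightarrow> complex) (\<gamma> :: 'a set \<Rightarrow> real \<Rightarrow> complex).
        inj_on p V \<and>
        (\<forall>e\<in>E. arc (\<gamma> e) \<and> {pathstart (\<gamma> e), pathfinish (\<gamma> e)} = p ` e \<and>
               path_image (\<gamma> e) \<inter> p ` V = p ` e) \<and>
        (\<forall>e\<in>E. \<forall>f\<in>E. e \<noteq> f \<longrightarrow> path_image (\<gamma> e) \<inter> path_image (\<gamma> f) \<subseteq> p ` (e \<inter> f)))"

text \<open>A cycle is given by the list of its vertices in cyclic order, the first one not repeated at the
  end; so its length is the length of the list.\<close>

definition is_cycle :: "'a set set \<Rightarrow> 'a list \<Rightarrow> bool" where
  "is_cycle E vs \<longleftrightarrow> length vs \<ge> 3 \<and> distinct vs \<and>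
     (\<forall>i < length vs. {vs ! i, vs ! (Suc i mod length vs)} \<in> E)"

text \<open>The girth of an acyclic graph is \<^term>\<open>\<infinity> :: enat\<close>, the infimum of the empty set.\<close>

definition girth :: "'a set set \<Rightarrow> enat" where
  "girth E = (INF vs \<in> {vs. is_cycle E vs}. enat (length vs))"

text \<open>The two disjuncts are the path \<^term>\<open>[a, b, c, d]\<close> of length three and, for \<^term>\<open>d = a\<close>, the
  triangle on \<^term>\<open>[a, b, c]\<close>.\<close>

definition consecutive :: "'a set set \<Rightarrow> 'a set \<Rightarrow> 'a set \<Rightarrow> 'a set \<Rightarrow> bool" where
  "consecutive E e\<^sub>1 e\<^sub>2 e\<^sub>3 \<longleftrightarrow> e\<^sub>1 \<in> E \<and> e\<^sub>2 \<in> E \<and> e\<^sub>3 \<in> E \<and>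
     (\<exists>a b c d. e\<^sub>1 = {a, b} \<and> e\<^sub>2 = {b, c} \<and> e\<^sub>3 = {c, d} \<and>
        (distinct [a, b, c, d] \<or> distinct [a, b, c] \<and> d = a))"

definition injective_edge_coloring :: "'a set set \<Rightarrow> nat \<Rightarrow> ('a set \<Rightarrow> nat) \<Rightarrow> bool" where
  "injective_edge_coloring E k c \<longleftrightarrow> c \<in> E \<rightarrow> {1..k} \<and>
     (\<forall>e\<^sub>1 e\<^sub>2 e\<^sub>3. consecutive E e\<^sub>1 e\<^sub>2 e\<^sub>3 \<longrightarrow> c e\<^sub>1 \<noteq> c e\<^sub>3)"

definition injective_chromatic_index :: "'a set set \<Rightarrow> nat" where
  "injective_chromatic_index E = (LEAST k. \<exists>c. injective_edge_coloring E k c)"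

text \<open>The minimum is attained: in a finite graph one may give every edge its own color.\<close>

lemma injective_edge_coloring_exists:
  assumes "simple_graph V E"
  shows "\<exists>k c. injective_edge_coloring E k c"
proof -
  have "finite E"
    using assms by (auto simp: simple_graph_def intro: finite_subset[of E "Pow V"])
  then obtain c where c: "bij_betw c E {1..card E}"
    using finite_same_card_bij[of E "{1..card E}"] by auto
  have "e\<^sub>1 \<noteq> e\<^sub>3" if "consecutive E e\<^sub>1 e\<^sub>2 e\<^sub>3" for e\<^sub>1 e\<^sub>2 e\<^sub>3
    using that by (auto simp: consecutive_def doubleton_eq_iff)
  then have "injective_edge_coloring E (card E) c"
    using c unfolding injective_edge_coloring_def bij_betw_def consecutive_def
    by (fastforce dest: inj_onD)
  then show ?thesis by blast
qed

lemma injective_chromatic_index_attained: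
  assumes "simple_graph V E"
  shows "\<exists>c. injective_edge_coloring E (injective_chromatic_index E) c"
  using injective_edge_coloring_exists[OF assms]
  unfolding injective_chromatic_index_def by (rule LeastI_ex)

end

(* Euler's formula is replaced by the inequality (k - 2) |E| + k <= k |V| for plane graphs without
   cycles shorter than k. It is additive over blocks. In a block, the part inside a cycle Z is bounded
   by induction: a path joining two vertices of Z through its inside splits the inside in two, by the
   theta-curve form of the Jordan curve theorem. The outside is turned into an inside by an inversion.
   Every induced subgraph is therefore sparse, and a minimal counterexample has minimum degree at least 2.
   In it every 3-vertex sends 1 to each neighbouring 2-vertex, or 2 if that vertex has another 2-vertex as
   neighbour. If no 3-vertex sends more than t, there are at most t/2 times as many 2-vertices as
   3-vertices, which sparsity forbids once k >= 6 + 2 t. The local configurations in which more is sent are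
   reducible: a colouring of the graph without them extends. For 7, 6, 5 and 4 colours, t is 0, 1, 2 and 5.
   For 5, 6, 7 colours the extension is greedy. For 4 colours pendant edges obstruct this, so every vertex of
   degree at most 2 carries the colour of a virtual pendant edge from the start. *)

theory Submission
  imports Defs
begin

section \<open>Paths and cycles\<close>

text \<open>Blocks are needed because a piece inside a cycle may hang on a single vertex of it, and
  then no path splits the inside. A block with a cycle satisfies the bound even with the constant
  \<open>2 k\<close>. The constant \<open>k\<close> is used because it also holds for an isolated
  vertex and for a single edge, and because gluing at a vertex preserves it. For four colours the
  first obstacle is already a vertex of degree 1: its edge can be in conflict with four others. If
  the other end carries a virtual pendant edge instead, a colour for the real edge is at hand, and
  only a new virtual colour has to be found, against at most two colours. Several cut edges at one
  vertex can all take its virtual colour, since edges that share an end may be coloured alike. The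
  same freedom settles a 3-vertex at which three threads meet: its three edges get one common
  colour.\<close>

fun path_edges :: "'a list \<Rightarrow> 'a set set" where
  "path_edges (x # y # xs) = insert {x, y} (path_edges (y # xs))"
| "path_edges _ = {}"

definition path_in :: "'a set set \<Rightarrow> 'a \<Rightarrow> 'a list \<Rightarrow> 'a \<Rightarrow> bool" where
  "path_in E x q y \<longleftrightarrow> q \<noteq> [] \<and> hd q = x \<and> last q = y \<and> distinct q \<and> path_edges q \<subseteq> E"

text \<open>Cycles are edge sets here, so that they can be cut into paths and assembled from paths
  without fixing a first vertex. \<open>cycle_set_card_ge\<close> makes the link to
  \<open>is_cycle\<close>.\<close>

definition cycle_set :: "'a set set \<Rightarrow> bool" where
  "cycle_set Z \<longleftrightarrow> (\<exists>q. 3 \<le> length q \<and> distinct q \<and> Z = insert {last q, hd q} (path_edges q))"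

lemma finite_path_edges [simp]: "finite (path_edges q)"
  by (induction q rule: path_edges.induct) auto

lemma path_edges_append:
  "\<lbrakk>xs \<noteq> []; ys \<noteq> []\<rbrakk> \<Longrightarrow>
    path_edges (xs @ ys) = insert {last xs, hd ys} (path_edges xs \<union> path_edges ys)"
proof (induction xs rule: path_edges.induct)
  case ("2_2" v)
  then show ?case by (cases ys) auto
qed auto

lemma path_edges_rev [simp]: "path_edges (rev xs) = path_edges xs"
proof (induction xs rule: path_edges.induct)
  case (1 x y xs)
  have "path_edges (rev (y # xs) @ [x]) = insert {y, x} (path_edges (rev (y # xs)))"
    using path_edges_append[of "rev (y # xs)" "[x]"] by (auto simp: last_rev)
  then show ?case using 1 by (simp add: insert_commute)
qed auto

lemma Union_path_edges_subset: "\<Union>(path_edges q) \<subseteq> set q"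
  by (induction q rule: path_edges.induct) auto

lemma path_edges_subset_set: "e \<in> path_edges q \<Longrightarrow> e \<subseteq> set q"
  using Union_path_edges_subset[of q] by auto

lemma Union_path_edges: "2 \<le> length q \<Longrightarrow> \<Union>(path_edges q) = set q"
proof (induction q rule: path_edges.induct)
  case (1 x y xs)
  then show ?case by (cases xs) auto
qed auto

lemma path_edges_nth: "path_edges q = {{q ! i, q ! Suc i} | i. Suc i < length q}"
proof (induction q rule: path_edges.induct)
  case (1 x y xs)
  have "{{(x # y # xs) ! i, (x # y # xs) ! Suc i} | i. Suc i < length (x # y # xs)} =
     insert {x, y} {{(y # xs) ! i, (y # xs) ! Suc i} | i. Suc i < length (y # xs)}" (is "?L = ?R")
  proof
    show "?L \<subseteq> ?R"
    proof
      fix e assume "e \<in> ?L"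
      then obtain i where "e = {(x # y # xs) ! i, (x # y # xs) ! Suc i}" "Suc i < length (x # y # xs)"
        by blast
      then show "e \<in> ?R" by (cases i) auto
    qed
    show "?R \<subseteq> ?L"
    proof
      fix e assume "e \<in> ?R"
      then consider "e = {x, y}" | i where "e = {(y # xs) ! i, (y # xs) ! Suc i}" "Suc i < length (y # xs)"
        by blast
      then show "e \<in> ?L"
      proof cases
        case 1 then show ?thesis by (auto intro!: exI[of _ 0])
      next
        case 2 then show ?thesis by (auto intro!: exI[of _ "Suc i"])
      qed
    qed
  qed
  then show ?case using 1 by simp
qed auto

lemma card_path_edges: "distinct q \<Longrightarrow> card (path_edges q) = length q - 1"
proof (induction q rule: path_edges.induct)
  case (1 x y xs)
  have "{x, y} \<notin> path_edges (y # xs)"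
    using 1 path_edges_subset_set[of "{x,y}" "y # xs"] by auto
  then show ?case using 1 by simp
qed auto

lemma card_cycle_edges:
  assumes "3 \<le> length q" "distinct q"
  shows "card (insert {last q, hd q} (path_edges q)) = length q"
proof -
  have q: "q \<noteq> []" using assms by auto
  have "{last q, hd q} \<notin> path_edges q"
  proof
    assume "{last q, hd q} \<in> path_edges q"
    then obtain i where i: "Suc i < length q" "{q ! (length q - 1), q ! 0} = {q ! i, q ! Suc i}"
      using q by (auto simp: path_edges_nth last_conv_nth hd_conv_nth)
    then consider "q ! (length q - 1) = q ! i" | "q ! (length q - 1) = q ! Suc i" "q ! 0 = q ! i"
      by (auto simp: doubleton_eq_iff)
    then show False
    proof cases
      case 1
      then have "length q - 1 = i" using assms i nth_eq_iff_index_eq[of q "length q - 1" i] by auto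
      then show ?thesis using i by simp
    next
      case 2
      then have "length q - 1 = Suc i" "0 = i"
        using assms i q nth_eq_iff_index_eq[of q "length q - 1" "Suc i"] nth_eq_iff_index_eq[of q 0 i]
        by auto
      then show ?thesis using assms by simp
    qed
  qed
  then show ?thesis using assms card_path_edges[of q] by simp
qed

lemma is_cycleI:
  assumes "3 \<le> length q" "distinct q" "insert {last q, hd q} (path_edges q) \<subseteq> E"
  shows "is_cycle E q"
proof -
  have q: "q \<noteq> []" using assms by auto
  have "{q ! i, q ! (Suc i mod length q)} \<in> E" if "i < length q" for i
  proof (cases "Suc i < length q")
    case True
    then have "{q ! i, q ! Suc i} \<in> path_edges q" by (auto simp: path_edges_nth)
    then show ?thesis using True assms by auto
  next
    case False
    then have "Suc i = length q" using that by simp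
    then have "Suc i mod length q = 0" "q ! i = last q"
      using q by (auto simp: last_conv_nth simp flip: \<open>Suc i = length q\<close>)
    then show ?thesis using assms q by (auto simp: hd_conv_nth)
  qed
  then show ?thesis using assms by (auto simp: is_cycle_def)
qed

lemma cycle_set_card_ge:
  assumes "cycle_set Z" "Z \<subseteq> E" "\<And>vs. is_cycle E vs \<Longrightarrow> k \<le> length vs"
  shows "k \<le> card Z"
proof -
  obtain q where q: "3 \<le> length q" "distinct q" "Z = insert {last q, hd q} (path_edges q)"
    using assms unfolding cycle_set_def by blast
  then show ?thesis using assms card_cycle_edges[of q] is_cycleI[of q E] by auto
qed

lemma cycle_set_Union_card:
  assumes "cycle_set Z"
  shows "finite Z" "card (\<Union>Z) = card Z" "Z \<noteq> {}"
proof -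
  obtain q where q: "3 \<le> length q" "distinct q" "Z = insert {last q, hd q} (path_edges q)"
    using assms unfolding cycle_set_def by blast
  then have "q \<noteq> []" by auto
  then have "\<Union>Z = set q" using q Union_path_edges[of q] by auto
  then show "card (\<Union>Z) = card Z" using q card_cycle_edges[of q] distinct_card[of q] by simp
  show "finite Z" "Z \<noteq> {}" using q by auto
qed

lemma path_in_ends:
  assumes "path_in E x q y" "x \<noteq> y"
  obtains cs where "q = x # cs @ [y]"
proof -
  obtain r where r: "q = x # r" using assms by (cases q) (auto simp: path_in_def)
  then have "r \<noteq> []" "last r = y" using assms by (auto simp: path_in_def split: if_splits)
  then show ?thesis using r that by (metis append_butlast_last_id)
qed

text \<open>Rotate the cyclic list so that it starts at \<open>x\<close> and cut it at
  \<open>y\<close>: one path runs forwards, the other runs backwards through the remaining segment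
  \<open>ds\<close>.\<close>

lemma cycle_set_split:
  assumes "cycle_set Z" "x \<in> \<Union>Z" "y \<in> \<Union>Z" "x \<noteq> y"
  obtains q1 q2 where "path_in Z x q1 y" "path_in Z x q2 y" "Z = path_edges q1 \<union> path_edges q2"
    "set q1 \<inter> set q2 = {x, y}" "path_edges q1 \<inter> path_edges q2 = {}"
proof -
  obtain q where q: "3 \<le> length q" "distinct q" "Z = insert {last q, hd q} (path_edges q)"
    using assms unfolding cycle_set_def by blast
  then have "q \<noteq> []" by auto
  then have Zq: "\<Union>Z = set q" using q Union_path_edges[of q] by auto
  then obtain as bs where ab: "q = as @ x # bs" using assms by (metis split_list)
  have Z: "Z = insert {last (x # bs @ as), x} (path_edges (x # bs @ as))"
  proof (cases "as = []")
    case True then show ?thesis using q ab by simp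
  next
    case False
    then show ?thesis using q ab path_edges_append[of as "x # bs"] path_edges_append[of "x # bs" as]
      by auto
  qed
  have "y \<in> set (bs @ as)" using assms Zq ab by auto
  then obtain cs ds where cd: "bs @ as = cs @ y # ds" by (metis split_list)
  have dist: "distinct (x # cs @ y # ds)" using q ab cd[symmetric] by auto
  let ?q1 = "x # cs @ [y]" and ?q2 = "x # rev ds @ [y]"
  have e1: "path_edges (x # cs @ y # ds) = path_edges ?q1 \<union> path_edges (y # ds)"
    using path_edges_append[of "x # cs" "y # ds"] path_edges_append[of "x # cs" "[y]"] by auto
  have e2: "path_edges ?q2 = insert {last (y # ds), x} (path_edges (y # ds))"
    using path_edges_append[of "[x]" "rev (y # ds)"] path_edges_rev[of "y # ds"]
    by (cases ds rule: rev_cases) (auto simp: insert_commute)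
  have ZU: "Z = path_edges ?q1 \<union> path_edges ?q2"
    using Z e1 e2 cd by auto
  \<comment> \<open>Edge-disjointness comes from counting: the two paths together have exactly as
    many edges as the cycle.\<close>
  have "card Z = length q" using q card_cycle_edges by auto
  also have "\<dots> = length cs + length ds + 2"
    using arg_cong[OF cd, of length] by (simp add: ab)
  also have "\<dots> = card (path_edges ?q1) + card (path_edges ?q2)"
    using card_path_edges[of ?q1] card_path_edges[of ?q2] dist by simp
  finally have "card (path_edges ?q1 \<inter> path_edges ?q2) = 0"
    using card_Un_Int[of "path_edges ?q1" "path_edges ?q2"] ZU by simp
  then have "path_edges ?q1 \<inter> path_edges ?q2 = {}" by simp
  moreover have "path_in Z x ?q1 y" "path_in Z x ?q2 y"
    using dist ZU by (auto simp: path_in_def)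
  moreover have "set ?q1 \<inter> set ?q2 = {x, y}" using dist by auto
  ultimately show ?thesis using that ZU by blast
qed

lemma cycle_set_join:
  assumes "path_in E x q1 y" "path_in E x q2 y" "x \<noteq> y" "set q1 \<inter> set q2 = {x, y}"
    "path_edges q1 \<inter> path_edges q2 = {}"
  shows "cycle_set (path_edges q1 \<union> path_edges q2)"
proof -
  obtain cs ds where cs: "q1 = x # cs @ [y]" and ds: "q2 = x # ds @ [y]"
    using assms path_in_ends by metis
  let ?q = "q1 @ rev ds"
  \<comment> \<open>Edge-disjointness excludes that both paths are the single edge from
    \<open>x\<close> to \<open>y\<close>, the only way to get a list shorter than 3.\<close>
  have "cs \<noteq> [] \<or> ds \<noteq> []" using assms cs ds by auto
  then have "3 \<le> length ?q" using cs by (cases cs; cases ds) auto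
  moreover have "distinct ?q" using assms cs ds by (auto simp: path_in_def)
  moreover have "insert {last ?q, hd ?q} (path_edges ?q) = path_edges q1 \<union> path_edges q2"
  proof (cases "ds = []")
    case True
    then show ?thesis using cs ds by (auto simp: insert_commute)
  next
    case False
    have a: "path_edges ?q = insert {y, last ds} (path_edges q1 \<union> path_edges ds)"
      using False path_edges_append[of q1 "rev ds"] cs by (simp add: hd_rev)
    have "path_edges q2 = insert {x, hd ds} (insert {last ds, y} (path_edges ds))"
      using False path_edges_append[of "[x]" "ds @ [y]"] path_edges_append[of ds "[y]"] ds by simp
    moreover have "last ?q = hd ds" "hd ?q = x" using False cs by (auto simp: last_rev)
    ultimately show ?thesis using a by (auto simp: insert_commute)
  qed
  ultimately show ?thesis unfolding cycle_set_def by blast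
qed

lemma rtrancl_path:
  assumes "(w, u) \<in> {(s, t). {s, t} \<in> F}\<^sup>*"
  shows "\<exists>q. path_in F w q u"
  using assms
proof (induction rule: rtrancl_induct)
  case base
  show ?case by (intro exI[of _ "[w]"]) (auto simp: path_in_def)
next
  case (step u t)
  then obtain q where q: "path_in F w q u" by blast
  show ?case
  proof (cases "t \<in> set q")
    case True
    then obtain as bs where ab: "q = as @ t # bs" by (metis split_list)
    have "path_edges (as @ [t]) \<subseteq> path_edges q"
      using path_edges_append[of as "t # bs"] path_edges_append[of as "[t]"] ab by (cases "as = []") auto
    then have "path_in F w (as @ [t]) t" using q ab by (cases as) (auto simp: path_in_def)
    then show ?thesis by blast
  next
    case False
    then have "path_in F w (q @ [t]) t"
      using q step path_edges_append[of q "[t]"] by (auto simp: path_in_def)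
    then show ?thesis by blast
  qed
qed

text \<open>A split is a separation into parts that share nothing or just a cut vertex. A nonempty
  edge set that is not splittable is that of a block: a single edge or a 2-connected graph.\<close>

definition splittable :: "'a set set \<Rightarrow> bool" where
  "splittable E \<longleftrightarrow> (\<exists>E1 E2. E = E1 \<union> E2 \<and> E1 \<inter> E2 = {} \<and> E1 \<noteq> {} \<and> E2 \<noteq> {} \<and>
      (\<exists>x. \<Union>E1 \<inter> \<Union>E2 \<subseteq> {x}))"

text \<open>The cycle goes through \<open>e\<close>: if no path avoiding \<open>e\<close> joined its
  ends, \<open>e\<close> would be a bridge, and a bridge beside another edge allows a split at one
  of its ends.\<close>

lemma not_splittable_cycle:
  assumes E: "\<And>e. e \<in> E \<Longrightarrow> card e = 2" and ns: "\<not> splittable E"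
    and e: "e \<in> E" and ne: "E \<noteq> {e}"
  obtains Z where "cycle_set Z" "Z \<subseteq> E"
proof -
  obtain x w where xw: "e = {x, w}" "x \<noteq> w" using E[OF e] by (auto simp: card_2_iff)
  let ?R = "{(s, t). {s, t} \<in> E - {e}}"
  define U where "U = {u. (w, u) \<in> ?R\<^sup>*}"
  have "x \<in> U"
  proof (rule ccontr)
    assume x: "x \<notin> U"
    define E1 where "E1 = {f \<in> E - {e}. f \<inter> U \<noteq> {}}"
    have E1U: "f \<subseteq> U" if f: "f \<in> E1" for f
    proof -
      obtain s t where st: "f = {s, t}" "s \<in> U" using f E[of f] by (auto simp: E1_def card_2_iff)
      then have "(s, t) \<in> ?R" using f by (auto simp: E1_def)
      then have "t \<in> U" using st rtrancl_into_rtrancl[of w s ?R t] by (auto simp: U_def)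
      then show ?thesis using st by simp
    qed
    have "w \<in> U" by (auto simp: U_def)
    have "splittable E"
    \<comment> \<open>Further edges on the side of \<open>w\<close> split off at \<open>w\<close>;
      if there are none, \<open>w\<close> is a leaf and \<open>e\<close> itself splits off at
      \<open>x\<close>.\<close>
    proof (cases "E1 = {}")
      case False
      have "\<Union>E1 \<inter> \<Union>(E - E1) \<subseteq> {w}"
      proof
        fix z assume z: "z \<in> \<Union>E1 \<inter> \<Union>(E - E1)"
        then have "z \<in> U" using E1U by auto
        obtain f where "f \<in> E" "f \<notin> E1" "z \<in> f" using z by auto
        then have "f = e" using \<open>z \<in> U\<close> by (auto simp: E1_def)
        then show "z \<in> {w}" using \<open>z \<in> f\<close> \<open>z \<in> U\<close> xw x by auto
      qed
      moreover have "e \<in> E - E1" using e by (auto simp: E1_def)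
      ultimately show ?thesis unfolding splittable_def using False
        by (intro exI[of _ E1] exI[of _ "E - E1"]) (auto simp: E1_def)
    next
      case True
      have "\<Union>{e} \<inter> \<Union>(E - {e}) \<subseteq> {x}"
        using True xw \<open>w \<in> U\<close> by (auto simp: E1_def)
      then show ?thesis unfolding splittable_def using e ne
        by (intro exI[of _ "{e}"] exI[of _ "E - {e}"]) auto
    qed
    then show False using ns by simp
  qed
  then obtain q where q: "path_in (E - {e}) w q x" using rtrancl_path[of w x "E - {e}"] by (auto simp: U_def)
  have p2: "path_in E w [w, x] x" using xw e by (auto simp: path_in_def insert_commute)
  obtain cs where cs: "q = w # cs @ [x]" using path_in_ends[OF q] xw by metis
  have "path_edges q \<inter> path_edges [w, x] = {}"
    using q xw by (auto simp: path_in_def insert_commute)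
  moreover have "set q \<inter> set [w, x] = {w, x}" using cs by auto
  moreover have "path_in E w q x" using q by (auto simp: path_in_def)
  ultimately have "cycle_set (path_edges q \<union> path_edges [w, x])"
    using cycle_set_join p2 xw(2) by metis
  then show ?thesis using that \<open>path_in E w q x\<close> p2 by (auto simp: path_in_def)
qed

section \<open>Density of plane graphs\<close>

lemma interior_arc_image:
  fixes g :: "real \<Rightarrow> complex"
  assumes "arc g"
  shows "interior (path_image g) = {}"
proof (rule ccontr)
  assume ne: "interior (path_image g) \<noteq> {}"
  obtain h where h: "homeomorphism {0..1} (path_image g) g h"
    using homeomorphism_arc[OF assms] by blast
  have "continuous_on (path_image g) h" "inj_on h (path_image g)"
    using h by (auto simp: homeomorphism_def intro: inj_on_inverseI[of _ g h])
  then have "continuous_on (interior (path_image g)) h" "inj_on h (interior (path_image g))"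
    using interior_subset[of "path_image g"] by (auto intro: continuous_on_subset inj_on_subset)
  \<comment> \<open>Otherwise \<open>h\<close> would map a nonempty open set of the plane
    continuously and injectively into the line.\<close>
  then have "DIM(complex) \<le> DIM(real)"
    using invariance_of_dimension[of "interior (path_image g)" h] ne by simp
  then show False by simp
qed

lemma interior_Union_closed_empty:
  assumes "finite A" "\<And>S. S \<in> A \<Longrightarrow> closed S \<and> interior S = {}"
  shows "interior (\<Union>A) = {}"
  using assms
proof (induction A)
  case (insert S A)
  then show ?case by (simp add: interior_closed_Un_empty_interior)
qed simp

lemma inside_connected_subset:
  assumes "connected S" "S \<inter> C = {}" "x \<in> S" "x \<in> inside C"
  shows "S \<subseteq> inside C"
proof
  fix y assume "y \<in> S"
  then have "connected_component (- C) x y"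
    using assms unfolding connected_component_def by blast
  then show "y \<in> inside C" using inside_same_component assms by metis
qed

lemma outside_connected_subset:
  assumes "connected S" "S \<inter> C = {}" "x \<in> S" "x \<in> outside C"
  shows "S \<subseteq> outside C"
proof
  fix y assume "y \<in> S"
  then have "connected_component (- C) x y"
    using assms unfolding connected_component_def by blast
  then show "y \<in> outside C" using outside_same_component assms by metis
qed

lemma inversion_outside_subset_inside:
  fixes C :: "complex set"
  assumes C: "compact C" and w: "w \<in> inside C"
  defines "\<phi> \<equiv> \<lambda>z. inverse (z - w)"
  shows "\<phi> ` outside C \<subseteq> inside (\<phi> ` C)"
proof
  define \<psi> where "\<psi> = (\<lambda>u::complex. w + inverse u)"
  \<comment> \<open>These hold without exception because \<open>inverse 0 = 0\<close>. At 0,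
    however, \<open>\<psi>\<close> yields \<open>w\<close> where infinity is meant, hence the
    separate treatment of 0 in \<open>W\<close> and \<open>W'\<close>.\<close>
  have inv: "\<phi> (\<psi> u) = u" "\<psi> (\<phi> z) = z" for u z by (auto simp: \<phi>_def \<psi>_def)
  have op: "open (- {0} \<inter> \<psi> -` S)" if "open S" for S
    using that by (intro continuous_open_preimage) (auto simp: \<psi>_def intro!: continuous_intros)
  define W where "W = insert 0 (- {0} \<inter> \<psi> -` outside C)"
  define W' where "W' = - {0} \<inter> \<psi> -` inside C"
  have opi: "open (inside C)" and opo: "open (outside C)"
    using C by (auto intro: open_inside open_outside compact_imp_closed)
  obtain r where r: "r > 0" "- outside C \<subseteq> ball 0 r"
    using cobounded_outside[OF compact_imp_bounded[OF C]] bounded_subset_ballD by blast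
  \<comment> \<open>Chosen so that \<open>norm u < s\<close> forces
    \<open>norm (\<psi> u) > r\<close>, where every point is outside.\<close>
  define s where "s = inverse (r + norm w)"
  have spos: "s > 0" using r by (auto simp: s_def intro: add_pos_nonneg)
  have "ball 0 s \<subseteq> W"
  proof
    fix u :: complex assume u: "u \<in> ball 0 s"
    show "u \<in> W"
    proof (cases "u = 0")
      case False
      then have "inverse (norm u) > inverse s"
        using u spos by (simp add: less_imp_inverse_less)
      then have "norm (inverse u) > r + norm w" by (simp add: s_def norm_inverse)
      then have "norm (\<psi> u) > r"
        using norm_diff_ineq[of "inverse u" w] by (simp add: \<psi>_def add.commute[of w])
      then have "\<psi> u \<in> outside C" using r by auto
      then show ?thesis using False by (simp add: W_def)
    qed (simp add: W_def)
  qed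
  then have "W = ball 0 s \<union> (- {0} \<inter> \<psi> -` outside C)"
    using spos by (auto simp: W_def)
  then have opW: "open W" using op[OF opo] by auto
  \<comment> \<open>A disc about \<open>w\<close> that lies inside \<open>C\<close> keeps
    \<open>\<psi> u\<close> away from \<open>w\<close>, which bounds \<open>norm u\<close> on
    \<open>W\<close>.\<close>
  obtain \<epsilon> where e: "\<epsilon> > 0" "ball w \<epsilon> \<subseteq> inside C" using opi w open_contains_ball by blast
  have "norm u \<le> inverse \<epsilon>" if "u \<in> W" for u
  proof (cases "u = 0")
    case False
    then have "\<psi> u \<notin> ball w \<epsilon>"
      using that e inside_Int_outside[of C] unfolding W_def by blast
    then have "\<epsilon> \<le> inverse (norm u)" by (simp add: \<psi>_def dist_norm norm_inverse)
    then show ?thesis using e False by (metis inverse_inverse_eq le_imp_inverse_le)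
  qed (use e in auto)
  then have bW: "bounded W" by (auto simp: bounded_iff)
  fix u assume "u \<in> \<phi> ` outside C"
  then obtain z where z: "u = \<phi> z" "z \<in> outside C" by blast
  have "z \<noteq> w" using z w inside_Int_outside[of C] by blast
  then have u0: "u \<noteq> 0" using z by (auto simp: \<phi>_def)
  have uW: "u \<in> W" using z u0 inv by (auto simp: W_def)
  have uC: "u \<notin> \<phi> ` C"
  proof
    assume "u \<in> \<phi> ` C"
    then have "z \<in> C" using z inv by (metis imageE)
    then show False using z by (meson disjoint_iff outside_no_overlap)
  qed
  let ?K = "connected_component_set (- \<phi> ` C) u"
  have cov: "?K \<subseteq> W \<union> W'"
  proof
    fix v assume "v \<in> ?K"
    then have "v \<notin> \<phi> ` C" using connected_component_subset by fastforce
    then have "\<psi> v \<notin> C" using inv by (metis imageI)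
    then have "\<psi> v \<in> inside C \<union> outside C" unfolding inside_Un_outside by simp
    then show "v \<in> W \<union> W'" unfolding W_def W'_def by blast
  qed
  have WW': "W \<inter> W' = {}" using inside_Int_outside[of C] unfolding W_def W'_def by blast
  have "open W'" unfolding W'_def by (rule op[OF opi])
  then have "W \<inter> ?K = {} \<or> W' \<inter> ?K = {}"
    using connectedD[OF connected_connected_component opW _ _ cov] WW' by blast
  moreover have "u \<in> ?K" using uC by simp
  ultimately have "?K \<subseteq> W" using uW cov by blast
  then show "u \<in> inside (\<phi> ` C)"
    using uC bW by (auto simp: inside_def intro: bounded_subset)
qed

text \<open>The witnesses of \<open>planar\<close> become locale parameters, so that the same graph
  can be interpreted a second time with the inverted drawing.\<close>

locale plane_graph =
  fixes V :: "'a set" and E :: "'a set set" and p :: "'a \<Rightarrow> complex"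
    and \<gamma> :: "'a set \<Rightarrow> real \<Rightarrow> complex"
  assumes finite_V: "finite V"
    and edge_subset: "\<And>e. e \<in> E \<Longrightarrow> e \<subseteq> V"
    and edge_card: "\<And>e. e \<in> E \<Longrightarrow> card e = 2"
    and inj_p: "inj_on p V"
    and arc_edge: "\<And>e. e \<in> E \<Longrightarrow> arc (\<gamma> e)"
    and edge_ends: "\<And>e. e \<in> E \<Longrightarrow> {pathstart (\<gamma> e), pathfinish (\<gamma> e)} = p ` e"
    and edge_vertices: "\<And>e. e \<in> E \<Longrightarrow> path_image (\<gamma> e) \<inter> p ` V = p ` e"
    and edge_edge: "\<And>e f. \<lbrakk>e \<in> E; f \<in> E; e \<noteq> f\<rbrakk> \<Longrightarrow>
          path_image (\<gamma> e) \<inter> path_image (\<gamma> f) \<subseteq> p ` (e \<inter> f)"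
begin

section \<open>Drawn edge sets and what lies inside them\<close>

definition drawn :: "'a set set \<Rightarrow> complex set" where
  "drawn Z = (\<Union>e\<in>Z. path_image (\<gamma> e))"

definition open_edge :: "'a set \<Rightarrow> complex set" where
  "open_edge e = path_image (\<gamma> e) - p ` e"

definition edges_inside :: "'a set set \<Rightarrow> 'a set set" where
  "edges_inside Z = {e \<in> E. open_edge e \<subseteq> inside (drawn Z)}"

definition vertices_inside :: "'a set set \<Rightarrow> 'a set" where
  "vertices_inside Z = {v \<in> V. p v \<in> inside (drawn Z)}"

lemma finite_E: "finite E"
  using finite_V edge_subset by (auto intro: finite_subset[of E "Pow V"])

lemma drawn_Un: "drawn (Y \<union> Z) = drawn Y \<union> drawn Z"
  by (auto simp: drawn_def)

lemma compact_drawn: "Z \<subseteq> E \<Longrightarrow> compact (drawn Z)"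
  unfolding drawn_def using finite_E arc_edge
  by (intro compact_UN) (auto intro: finite_subset compact_path_image arc_imp_path)

lemma open_edge_eq:
  "e \<in> E \<Longrightarrow> open_edge e = path_image (\<gamma> e) - {pathstart (\<gamma> e), pathfinish (\<gamma> e)}"
  using edge_ends by (simp add: open_edge_def)

lemma connected_open_edge: "e \<in> E \<Longrightarrow> connected (open_edge e)"
  using arc_edge by (simp add: open_edge_eq connected_simple_path_endless arc_imp_simple_path)

lemma open_edge_nonempty: "e \<in> E \<Longrightarrow> open_edge e \<noteq> {}"
  using arc_edge nonempty_simple_path_endless arc_imp_simple_path
  by (auto simp: open_edge_eq simp del: Diff_eq_empty_iff)

lemma connected_open_edge_insert:
  assumes e: "e \<in> E" and v: "v \<in> e"
  shows "connected (insert (p v) (open_edge e))"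
proof -
  let ?g = "\<gamma> e"
  have pv: "p v = pathstart ?g \<or> p v = pathfinish ?g" using edge_ends[OF e] v by blast
  have sp: "simple_path ?g" using arc_edge[OF e] by (rule arc_imp_simple_path)
  then have cont: "continuous_on {0..1} ?g" by (simp add: simple_path_def path_def)
  have o: "open_edge e = ?g ` {0<..<1}"
    using open_edge_eq[OF e] simple_path_endless[OF sp] by simp
  have 01: "insert (0::real) {0<..<1} = {0..<1}" "insert (1::real) {0<..<1} = {0<..1}" by auto
  from pv show ?thesis
  proof
    assume "p v = pathstart ?g"
    then have "insert (p v) (open_edge e) = ?g ` {0..<1}" unfolding o 01(1)[symmetric]
      by (simp add: pathstart_def)
    then show ?thesis using cont
      by (auto intro!: connected_continuous_image intro: continuous_on_subset)
  next
    assume "p v = pathfinish ?g"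
    then have "insert (p v) (open_edge e) = ?g ` {0<..1}" unfolding o 01(2)[symmetric]
      by (simp add: pathfinish_def)
    then show ?thesis using cont
      by (auto intro!: connected_continuous_image intro: continuous_on_subset)
  qed
qed

lemma open_edge_drawn:
  assumes "Z \<subseteq> E" "e \<in> E" "e \<notin> Z"
  shows "open_edge e \<inter> drawn Z = {}"
  using assms edge_edge[of e] unfolding open_edge_def drawn_def by blast

lemma open_edge_subset_drawn: "e \<in> Z \<Longrightarrow> open_edge e \<subseteq> drawn Z"
  by (auto simp: drawn_def open_edge_def)

lemma vertex_in_drawn:
  assumes "Z \<subseteq> E" "v \<in> V"
  shows "p v \<in> drawn Z \<longleftrightarrow> v \<in> \<Union>Z"
proof
  assume "p v \<in> drawn Z"
  then obtain e where e: "e \<in> Z" "p v \<in> path_image (\<gamma> e)" by (auto simp: drawn_def)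
  then have "p v \<in> p ` e" using assms edge_vertices by blast
  then obtain u where "u \<in> e" "p u = p v" by auto
  then have "v \<in> e" using e assms inj_p edge_subset by (metis inj_onD subsetD)
  then show "v \<in> \<Union>Z" using e by auto
next
  assume "v \<in> \<Union>Z"
  then obtain e where e: "e \<in> Z" "v \<in> e" by auto
  then have "p v \<in> path_image (\<gamma> e)" using assms edge_vertices by blast
  then show "p v \<in> drawn Z" using e by (auto simp: drawn_def)
qed

lemma edges_inside_disjoint:
  assumes "e \<in> edges_inside Z" shows "e \<notin> Z" "e \<in> E"
  using assms open_edge_nonempty[of e] open_edge_subset_drawn[of e Z] inside_no_overlap[of "drawn Z"]
  unfolding edges_inside_def by blast+

lemma edges_insideI:
  assumes "Z \<subseteq> E" "e \<in> E" "e \<notin> Z" "z \<in> open_edge e" "z \<in> inside (drawn Z)"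
  shows "e \<in> edges_inside Z"
  using inside_connected_subset[OF connected_open_edge open_edge_drawn] assms
  by (auto simp: edges_inside_def)

text \<open>An open edge together with an end off the cycle is connected and misses the drawn cycle,
  so edge and end lie on the same side.\<close>

lemma vertices_inside_iff:
  assumes "Z \<subseteq> E" "e \<in> E" "v \<in> e" "v \<notin> \<Union>Z"
  shows "v \<in> vertices_inside Z \<longleftrightarrow> e \<in> edges_inside Z"
proof -
  have eZ: "e \<notin> Z" and vV: "v \<in> V" using assms edge_subset by auto
  have con: "connected (insert (p v) (open_edge e))" by (rule connected_open_edge_insert) fact+
  have disj: "insert (p v) (open_edge e) \<inter> drawn Z = {}"
    using vertex_in_drawn[OF assms(1) vV] open_edge_drawn[OF assms(1,2) eZ] assms by auto
  show ?thesis
  proof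
    assume "v \<in> vertices_inside Z"
    then show "e \<in> edges_inside Z"
      using inside_connected_subset[OF con disj, of "p v"] assms
      by (auto simp: vertices_inside_def edges_inside_def)
  next
    assume e: "e \<in> edges_inside Z"
    obtain z where "z \<in> open_edge e" using open_edge_nonempty assms by blast
    then show "v \<in> vertices_inside Z"
      using inside_connected_subset[OF con disj, of z] e vV
      by (auto simp: vertices_inside_def edges_inside_def)
  qed
qed

lemma arc_of_edge:
  assumes e: "{x, y} \<in> E"
  shows "\<exists>h. arc h \<and> pathstart h = p x \<and> pathfinish h = p y \<and> path_image h = path_image (\<gamma> {x, y})"
proof -
  have "{pathstart (\<gamma> {x, y}), pathfinish (\<gamma> {x, y})} = {p x, p y}"
    using edge_ends[OF e] by simp
  then consider "pathstart (\<gamma> {x, y}) = p x" "pathfinish (\<gamma> {x, y}) = p y"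
    | "pathstart (\<gamma> {x, y}) = p y" "pathfinish (\<gamma> {x, y}) = p x"
    by (auto simp: doubleton_eq_iff)
  then show ?thesis
  proof cases
    case 1 then show ?thesis using arc_edge[OF e] by blast
  next
    case 2 then show ?thesis using arc_edge[OF e]
      by (intro exI[of _ "reversepath (\<gamma> {x, y})"]) (auto simp: arc_reversepath)
  qed
qed

lemma arc_of_path:
  assumes "path_in E x q y" "x \<noteq> y"
  shows "\<exists>h. arc h \<and> pathstart h = p x \<and> pathfinish h = p y \<and> path_image h = drawn (path_edges q)"
  using assms
proof (induction q arbitrary: x rule: path_edges.induct)
  case (1 a z r)
  have a: "a = x" using 1 by (simp add: path_in_def)
  have xz: "{x, z} \<in> E" and zr: "path_in E z (z # r) y" using 1 by (auto simp: path_in_def)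
  obtain h1 where h1: "arc h1" "pathstart h1 = p x" "pathfinish h1 = p z"
    "path_image h1 = path_image (\<gamma> {x, z})" using arc_of_edge[OF xz] by blast
  show ?case
  proof (cases "z = y")
    case True
    then have "r = []" using zr by (cases r) (auto simp: path_in_def split: if_splits)
    then show ?thesis using h1 True a by (auto simp: drawn_def)
  next
    case False
    then obtain h2 where h2: "arc h2" "pathstart h2 = p z" "pathfinish h2 = p y"
      "path_image h2 = drawn (path_edges (z # r))" using 1(1)[OF zr] by blast
    have "path_image h1 \<inter> path_image h2 \<subseteq> {p z}"
    proof
      fix t assume t: "t \<in> path_image h1 \<inter> path_image h2"
      then obtain f where f: "f \<in> path_edges (z # r)" "t \<in> path_image (\<gamma> f)" using h2
        by (auto simp: drawn_def)
      have fE: "f \<in> E" using f zr by (auto simp: path_in_def)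
      have xf: "x \<notin> f" using path_edges_subset_set[OF f(1)] 1(2) a by (auto simp: path_in_def)
      then have "t \<in> p ` ({x, z} \<inter> f)" using edge_edge[OF xz fE] t f h1 by auto
      then show "t \<in> {p z}" using xf by auto
    qed
    then have "arc (h1 +++ h2)" using h1 h2 by (intro arc_join) auto
    moreover have "path_image (h1 +++ h2) = drawn (path_edges (a # z # r))"
      using h1 h2 a by (auto simp: path_image_join drawn_def)
    ultimately show ?thesis using h1 h2 by (intro exI[of _ "h1 +++ h2"]) auto
  qed
qed (auto simp: path_in_def)

lemma drawn_paths_Int:
  assumes "path_edges q1 \<subseteq> E" "path_edges q2 \<subseteq> E" "set q1 \<inter> set q2 = {x, y}"
    "path_edges q1 \<inter> path_edges q2 = {}"
  shows "drawn (path_edges q1) \<inter> drawn (path_edges q2) \<subseteq> {p x, p y}"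
proof
  fix t assume "t \<in> drawn (path_edges q1) \<inter> drawn (path_edges q2)"
  then obtain e f where ef: "e \<in> path_edges q1" "f \<in> path_edges q2"
    "t \<in> path_image (\<gamma> e)" "t \<in> path_image (\<gamma> f)" by (auto simp: drawn_def)
  then have "e \<noteq> f" "e \<in> E" "f \<in> E" using assms by auto
  then have "t \<in> p ` (e \<inter> f)" using edge_edge[of e f] ef by auto
  moreover have "e \<inter> f \<subseteq> {x, y}"
    using path_edges_subset_set[OF ef(1)] path_edges_subset_set[OF ef(2)] assms(3) by blast
  ultimately show "t \<in> {p x, p y}" by auto
qed

text \<open>In a block, whatever lies inside the cycle is attached to it at two vertices at least;
  attached at one or none, it would split off.\<close>

lemma ear_inside:
  assumes ns: "\<not> splittable E" and Z: "cycle_set Z" "Z \<subseteq> E" and ne: "edges_inside Z \<noteq> {}"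
  obtains x y q where "path_in E x q y" "x \<noteq> y" "set q \<inter> \<Union>Z = {x, y}"
    "path_edges q \<inter> Z = {}" "path_edges q \<inter> edges_inside Z \<noteq> {}"
proof -
  have Zne: "Z \<noteq> {}" using cycle_set_Union_card(3)[OF Z(1)] .
  have ZE: "Z \<subseteq> E - edges_inside Z" using edges_inside_disjoint Z by blast
  \<comment> \<open>Otherwise the edges inside would share no vertex with the remaining
    edges.\<close>
  have "\<exists>e \<in> edges_inside Z. e \<inter> \<Union>Z \<noteq> {}"
  proof (rule ccontr)
    assume no: "\<not> ?thesis"
    have "\<Union>(edges_inside Z) \<inter> \<Union>(E - edges_inside Z) = {}"
    proof (rule ccontr)
      assume "\<not> ?thesis"
      then obtain v e f where v: "v \<in> e" "v \<in> f" "e \<in> edges_inside Z" "f \<in> E" "f \<notin> edges_inside Z"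
        by blast
      then have "v \<notin> \<Union>Z" using no by blast
      then show False
        using v vertices_inside_iff[OF Z(2), of e v] vertices_inside_iff[OF Z(2), of f v]
          edges_inside_disjoint by blast
    qed
    then have "splittable E" unfolding splittable_def using ne ZE Zne
      by (intro exI[of _ "edges_inside Z"] exI[of _ "E - edges_inside Z"])
        (auto simp: edges_inside_def)
    then show False using ns by simp
  qed
  then obtain e x where e: "e \<in> edges_inside Z" and x: "x \<in> e" "x \<in> \<Union>Z" by blast
  have eE: "e \<in> E" "e \<notin> Z" using edges_inside_disjoint[OF e] by auto
  obtain w where w: "e = {x, w}" "x \<noteq> w"
    using edge_card[OF eE(1)] x by (auto simp: card_2_iff doubleton_eq_iff)
  show ?thesis
  proof (cases "w \<in> \<Union>Z")
    case True
    have "path_in E x [x, w] w" using w eE by (auto simp: path_in_def)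
    then show ?thesis using that[of x "[x, w]" w] True x w e eE by auto
  next
    case False
    define F where "F = {f \<in> E. f \<inter> \<Union>Z = {}}"
    let ?R = "{(s, t). {s, t} \<in> F}"
    \<comment> \<open>The part reached from \<open>w\<close> without touching the cycle; it cannot
      leave the inside.\<close>
    define U where "U = {u. (w, u) \<in> ?R\<^sup>*}"
    have U: "u \<notin> \<Union>Z \<and> u \<in> vertices_inside Z" if "u \<in> U" for u
    proof -
      have "(w, u) \<in> ?R\<^sup>*" using that by (simp add: U_def)
      then show ?thesis
      proof (induction rule: rtrancl_induct)
        case base
        then show ?case using False vertices_inside_iff[OF Z(2) eE(1), of w] w e by auto
      next
        case (step s t)
        then have st: "{s, t} \<in> E" "t \<notin> \<Union>Z" by (auto simp: F_def)
        then show ?case using step vertices_inside_iff[OF Z(2) st(1), of s]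
            vertices_inside_iff[OF Z(2) st(1), of t] by auto
      qed
    qed
    define B where "B = {f \<in> E. f \<inter> U \<noteq> {}}"
    have BM: "f \<in> edges_inside Z" if "f \<in> B" for f
      using that U vertices_inside_iff[OF Z(2), of f] unfolding B_def by blast
    have "w \<in> U" by (simp add: U_def)
    \<comment> \<open>If all edges at \<open>U\<close> ended in \<open>U\<close> or at
      \<open>x\<close>, then \<open>x\<close> would be a cut vertex. An edge that leaves must end on
      the cycle, by the choice of \<open>U\<close>.\<close>
    have "\<exists>f\<in>B. \<not> f \<subseteq> insert x U"
    proof (rule ccontr)
      assume no: "\<not> ?thesis"
      have "\<Union>B \<inter> \<Union>(E - B) \<subseteq> {x}"
      proof
        fix v assume v: "v \<in> \<Union>B \<inter> \<Union>(E - B)"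
        then have "v \<in> insert x U" using no by blast
        moreover have "v \<notin> U" using v by (auto simp: B_def)
        ultimately show "v \<in> {x}" by simp
      qed
      moreover have "e \<in> B" using eE w \<open>w \<in> U\<close> by (auto simp: B_def)
      moreover have "Z \<subseteq> E - B" using ZE BM by blast
      ultimately have "splittable E" unfolding splittable_def using Zne
        by (intro exI[of _ B] exI[of _ "E - B"]) (auto simp: B_def)
      then show False using ns by simp
    qed
    then obtain f y where fy: "f \<in> B" "y \<in> f" "y \<noteq> x" "y \<notin> U" by blast
    then obtain u where u: "u \<in> f" "u \<in> U" by (auto simp: B_def)
    have fE: "f \<in> E" using fy by (simp add: B_def)
    have fuy: "f = {u, y}"
      using edge_card[OF fE] fy u by (auto simp: card_2_iff doubleton_eq_iff)
    have yZ: "y \<in> \<Union>Z"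
    proof (rule ccontr)
      assume "y \<notin> \<Union>Z"
      then have "(u, y) \<in> ?R" using U[OF u(2)] fuy fE by (auto simp: F_def)
      then have "y \<in> U" using u rtrancl_into_rtrancl[of w u ?R y] by (auto simp: U_def)
      then show False using fy by simp
    qed
    obtain q0 where q0: "path_in F w q0 u" using u rtrancl_path[of w u F] by (auto simp: U_def)
    have sq0: "set q0 \<inter> \<Union>Z = {}"
    proof (cases "2 \<le> length q0")
      case True
      then have "set q0 = \<Union>(path_edges q0)" using Union_path_edges by metis
      then show ?thesis using q0 unfolding path_in_def F_def by blast
    next
      case False
      then have "q0 = [w]" using q0 by (cases q0) (auto simp: path_in_def Suc_le_eq)
      then show ?thesis using \<open>w \<notin> \<Union>Z\<close> by simp
    qed
    let ?q = "x # q0 @ [y]"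
    have pe: "path_edges ?q = insert e (insert f (path_edges q0))"
    proof -
      have "q0 \<noteq> []" "hd q0 = w" "last q0 = u" using q0 by (auto simp: path_in_def)
      then show ?thesis
        using path_edges_append[of "[x]" "q0 @ [y]"] path_edges_append[of q0 "[y]"] w fuy by auto
    qed
    have "path_in E x ?q y"
      using q0 pe eE fE sq0 x yZ fy by (auto simp: path_in_def F_def)
    moreover have "set ?q \<inter> \<Union>Z = {x, y}" using sq0 x yZ by auto
    moreover have "path_edges ?q \<inter> Z = {}"
    proof -
      have "f \<notin> Z" using U[OF u(2)] u by blast
      moreover have "g \<notin> Z" if "g \<in> F" for g
        using that edge_card[of g] unfolding F_def by (cases "g = {}") auto
      ultimately show ?thesis using pe eE q0 by (auto simp: path_in_def)
    qed
    ultimately show ?thesis using that[of x ?q y] fy pe e by auto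
  qed
qed

text \<open>With nothing inside, this is the girth bound. Otherwise a path with \<open>l\<close>
  edges and \<open>l - 1\<close> inner vertices cuts the inside, and the two new cycles have
  \<open>card Z + 2 l\<close> edges together. Adding the two bounds and \<open>(k - 2) l\<close> for
  the path leaves \<open>k l\<close> on the right: \<open>k (l - 1)\<close> for the inner vertices
  and one \<open>k\<close> that pays for the second constant.\<close>

lemma inside_count:
  assumes ns: "\<not> splittable E" and k: "2 \<le> k"
    and girth: "\<And>Z. \<lbrakk>cycle_set Z; Z \<subseteq> E\<rbrakk> \<Longrightarrow> k \<le> card Z"
    and Z: "cycle_set Z" "Z \<subseteq> E"
  shows "(k - 2) * card (edges_inside Z) + k \<le> k * card (vertices_inside Z) + card Z"
  using Z
proof (induction "card (edges_inside Z)" arbitrary: Z rule: less_induct)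
  case less
  note Z = less.prems
  have fin: "finite (edges_inside Y)" "finite (vertices_inside Y)" for Y
    using finite_E finite_V by (auto simp: edges_inside_def vertices_inside_def)
  show ?case
  proof (cases "edges_inside Z = {}")
    case True
    then show ?thesis using girth[OF Z] by (simp add: trans_le_add2)
  next
    case False
    then obtain x y q where q: "path_in E x q y" "x \<noteq> y" "set q \<inter> \<Union>Z = {x, y}"
      "path_edges q \<inter> Z = {}" "path_edges q \<inter> edges_inside Z \<noteq> {}"
      using ear_inside[OF ns Z] by metis
    then have "x \<in> \<Union>Z" "y \<in> \<Union>Z" by auto
    then obtain q1 q2 where p1: "path_in Z x q1 y" and p2: "path_in Z x q2 y"
      and Zq: "Z = path_edges q1 \<union> path_edges q2" "set q1 \<inter> set q2 = {x, y}"
        "path_edges q1 \<inter> path_edges q2 = {}"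
      using cycle_set_split[OF Z(1) _ _ q(2)] by metis
    have q1E: "path_in E x q1 y" "path_in E x q2 y" using p1 p2 Z by (auto simp: path_in_def)
    obtain cs where cs: "q = x # cs @ [y]" using path_in_ends[OF q(1,2)] .
    obtain c1 c2 c where
      c1: "arc c1" "pathstart c1 = p x" "pathfinish c1 = p y" "path_image c1 = drawn (path_edges q1)" and
      c2: "arc c2" "pathstart c2 = p x" "pathfinish c2 = p y" "path_image c2 = drawn (path_edges q2)" and
      c: "arc c" "pathstart c = p x" "pathfinish c = p y" "path_image c = drawn (path_edges q)"
      using arc_of_path q1E q(1,2) by metis
    have ends: "p x \<in> path_image c1 \<inter> path_image c2 \<inter> path_image c"
      "p y \<in> path_image c1 \<inter> path_image c2 \<inter> path_image c"
      using c1 c2 c pathstart_in_path_image pathfinish_in_path_image by (metis IntI)+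
    have qi_Z: "set q1 \<subseteq> \<Union>Z" "set q2 \<subseteq> \<Union>Z"
    proof -
      obtain cs1 cs2 where "q1 = x # cs1 @ [y]" "q2 = x # cs2 @ [y]"
        using path_in_ends q1E q(2) by metis
      then have "2 \<le> length q1" "2 \<le> length q2" by auto
      then show "set q1 \<subseteq> \<Union>Z" "set q2 \<subseteq> \<Union>Z"
        using Union_path_edges[of q1] Union_path_edges[of q2] Zq(1) by auto
    qed
    have ends_in: "{x, y} \<subseteq> set q1" "{x, y} \<subseteq> set q2" using Zq(2) by auto
    have i1: "set q1 \<inter> set q = {x, y}" and i2: "set q2 \<inter> set q = {x, y}"
      using q(3) qi_Z ends_in by auto
    have e1: "path_edges q1 \<inter> path_edges q = {}" and e2: "path_edges q2 \<inter> path_edges q = {}"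
      using q(4) Zq(1) by auto
    have peE: "path_edges q1 \<subseteq> E" "path_edges q2 \<subseteq> E" "path_edges q \<subseteq> E"
      using q1E q(1) by (auto simp: path_in_def)
    let ?Z1 = "path_edges q1 \<union> path_edges q" and ?Z2 = "path_edges q2 \<union> path_edges q"
    have cyc: "cycle_set ?Z1" "cycle_set ?Z2"
      using cycle_set_join q1E q(1,2) i1 i2 e1 e2 by metis+
    have sub: "?Z1 \<subseteq> E" "?Z2 \<subseteq> E" using peE by auto
    have pxy: "p x \<noteq> p y"
      using c(1) c(2,3) arc_distinct_ends by metis
    have d: "drawn Z = path_image c1 \<union> path_image c2" "drawn ?Z1 = path_image c1 \<union> path_image c"
      "drawn ?Z2 = path_image c2 \<union> path_image c"
      using Zq(1) c1 c2 c by (auto simp: drawn_Un)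
    obtain e0 where e0: "e0 \<in> path_edges q" "e0 \<in> edges_inside Z" using q(5) by blast
    have e0E: "e0 \<in> E" using edges_inside_disjoint e0 by blast
    \<comment> \<open>The theta-curve theorem asks only that the middle arc meets the inside; its
      conclusion then places the whole arc there, up to its ends.\<close>
    have cin: "path_image c \<inter> inside (path_image c1 \<union> path_image c2) \<noteq> {}"
      using e0 open_edge_nonempty[OF e0E] open_edge_subset_drawn[OF e0(1)] c(4) d(1)
      unfolding edges_inside_def by auto
    have ints: "path_image c1 \<inter> path_image c2 = {p x, p y}" "path_image c1 \<inter> path_image c = {p x, p y}"
      "path_image c2 \<inter> path_image c = {p x, p y}"
      using drawn_paths_Int[OF peE(1,2) Zq(2,3)] drawn_paths_Int[OF peE(1,3) i1 e1]
        drawn_paths_Int[OF peE(2,3) i2 e2] ends c1(4) c2(4) c(4) by auto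
    note simple = arc_imp_simple_path[OF c1(1)] arc_imp_simple_path[OF c2(1)] arc_imp_simple_path[OF c(1)]
    have "inside (drawn ?Z1) \<inter> inside (drawn ?Z2) = {} \<and>
       inside (drawn ?Z1) \<union> inside (drawn ?Z2) \<union> (path_image c - {p x, p y}) = inside (drawn Z)"
      unfolding d
      by (rule split_inside_simple_closed_curve[OF simple(1) c1(2,3) simple(2) c2(2,3) simple(3) c(2,3)
            pxy ints cin]) blast
    then have disj: "inside (drawn ?Z1) \<inter> inside (drawn ?Z2) = {}"
      and un: "inside (drawn ?Z1) \<union> inside (drawn ?Z2) \<union> (path_image c - {p x, p y}) = inside (drawn Z)"
      by blast+
    have sub1: "edges_inside ?Z1 \<subseteq> edges_inside Z" "edges_inside ?Z2 \<subseteq> edges_inside Z"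
      using un unfolding edges_inside_def by auto
    \<comment> \<open>The edge \<open>e0\<close> lies inside \<open>Z\<close> but on both new
      cycles, so the number of edges inside drops.\<close>
    have "e0 \<notin> edges_inside ?Z1" "e0 \<notin> edges_inside ?Z2"
      using edges_inside_disjoint(1) e0(1) by blast+
    then have less: "card (edges_inside ?Z1) < card (edges_inside Z)"
      "card (edges_inside ?Z2) < card (edges_inside Z)"
      using sub1 e0(2) fin by (auto intro!: psubset_card_mono)
    have IH1: "(k - 2) * card (edges_inside ?Z1) + k \<le> k * card (vertices_inside ?Z1) + card ?Z1"
      by (rule less.hyps[OF less(1) cyc(1) sub(1)])
    have IH2: "(k - 2) * card (edges_inside ?Z2) + k \<le> k * card (vertices_inside ?Z2) + card ?Z2"
      by (rule less.hyps[OF less(2) cyc(2) sub(2)])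
    have "edges_inside Z \<subseteq> edges_inside ?Z1 \<union> edges_inside ?Z2 \<union> path_edges q"
    proof
      fix f assume f: "f \<in> edges_inside Z"
      have fE: "f \<in> E" "f \<notin> Z" using edges_inside_disjoint[OF f] by auto
      obtain z where z: "z \<in> open_edge f" using open_edge_nonempty[OF fE(1)] by blast
      show "f \<in> edges_inside ?Z1 \<union> edges_inside ?Z2 \<union> path_edges q"
      proof (cases "f \<in> path_edges q")
        case False
        have "z \<notin> path_image c" using open_edge_drawn[OF peE(3) fE(1) False] z c(4) by auto
        then have "z \<in> inside (drawn ?Z1) \<union> inside (drawn ?Z2)"
          using un z f by (auto simp: edges_inside_def)
        then show ?thesis
          using edges_insideI[OF sub(1) fE(1) _ z] edges_insideI[OF sub(2) fE(1) _ z] fE Zq(1) False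
          by auto
      qed simp
    qed
    then have "card (edges_inside Z) \<le> card (edges_inside ?Z1 \<union> edges_inside ?Z2 \<union> path_edges q)"
      using fin by (intro card_mono) auto
    also have "\<dots> \<le> card (edges_inside ?Z1) + card (edges_inside ?Z2) + card (path_edges q)"
      by (meson card_Un_le add_le_mono1 le_trans)
    finally have m: "card (edges_inside Z) \<le>
        card (edges_inside ?Z1) + card (edges_inside ?Z2) + card (path_edges q)" .
    have csd: "distinct q" using q(1) by (simp add: path_in_def)
    have csV: "set cs \<subseteq> V"
      using Union_path_edges[of q] cs peE(3) edge_subset by fastforce
    have cs_notin: "v \<notin> vertices_inside ?Z1" "v \<notin> vertices_inside ?Z2" "p v \<in> path_image c - {p x, p y}"
      if v: "v \<in> set cs" for v
    proof -
      have vU: "v \<in> \<Union>(path_edges q)" using v Union_path_edges[of q] cs by simp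
      have pv: "p v \<in> path_image c" using vertex_in_drawn[OF peE(3)] vU csV v c(4) by auto
      then show "v \<notin> vertices_inside ?Z1" "v \<notin> vertices_inside ?Z2"
        using d(2,3) inside_no_overlap[of "drawn ?Z1"] inside_no_overlap[of "drawn ?Z2"]
        unfolding vertices_inside_def by blast+
      have "x \<in> V" "y \<in> V" using \<open>x \<in> \<Union>Z\<close> \<open>y \<in> \<Union>Z\<close> Z(2) edge_subset by auto
      then have "p v \<noteq> p x" "p v \<noteq> p y"
        using inj_p csV v csd cs inj_onD[of p V v x] inj_onD[of p V v y] by auto
      then show "p v \<in> path_image c - {p x, p y}" using pv by simp
    qed
    have "vertices_inside ?Z1 \<union> vertices_inside ?Z2 \<union> set cs \<subseteq> vertices_inside Z"
      using un cs_notin(3) csV unfolding vertices_inside_def by blast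
    then have "card (vertices_inside ?Z1 \<union> vertices_inside ?Z2 \<union> set cs) \<le> card (vertices_inside Z)"
      using fin by (intro card_mono) auto
    moreover have "card (vertices_inside ?Z1 \<union> vertices_inside ?Z2 \<union> set cs) =
        card (vertices_inside ?Z1) + card (vertices_inside ?Z2) + card (set cs)"
    proof -
      have "vertices_inside ?Z1 \<inter> vertices_inside ?Z2 = {}"
        using disj unfolding vertices_inside_def by blast
      moreover have "(vertices_inside ?Z1 \<union> vertices_inside ?Z2) \<inter> set cs = {}"
        using cs_notin(1,2) by blast
      ultimately show ?thesis using fin by (simp add: card_Un_disjoint)
    qed
    ultimately have n: "card (vertices_inside ?Z1) + card (vertices_inside ?Z2) + card (set cs)
        \<le> card (vertices_inside Z)" by simp
    have pq: "card (path_edges q) = card (set cs) + 1"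
      using card_path_edges[OF csd] csd cs distinct_card[of cs] by simp
    have Z1: "card ?Z1 = card (path_edges q1) + card (path_edges q)"
      "card ?Z2 = card (path_edges q2) + card (path_edges q)"
      "card Z = card (path_edges q1) + card (path_edges q2)"
      using e1 e2 Zq(1,3) by (auto simp: card_Un_disjoint)
    obtain j where j: "k = j + 2" using k by (metis add.commute le_Suc_ex)
    have "j * card (edges_inside Z) \<le>
       j * (card (edges_inside ?Z1) + card (edges_inside ?Z2) + card (path_edges q))"
      using m by simp
    moreover have "(j + 2) * (card (vertices_inside ?Z1) + card (vertices_inside ?Z2) + card (set cs))
        \<le> (j + 2) * card (vertices_inside Z)" using n by (rule mult_le_mono2)
    ultimately show ?thesis using IH1 IH2 Z1 pq unfolding j by (simp add: algebra_simps)
  qed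
qed

end

text \<open>The punctured inside has a connected image that misses the image of \<open>C\<close> and
  is unbounded near \<open>w\<close>, so it lies in no bounded component. This prevents vertices
  from being counted on both sides of a cycle.\<close>

lemma inversion_inside_disjoint_inside:
  fixes C :: "complex set"
  assumes C: "compact C" and con: "connected (inside C)" and w: "w \<in> inside C"
  defines "\<phi> \<equiv> \<lambda>z. inverse (z - w)"
  shows "\<phi> ` (inside C - {w}) \<inter> inside (\<phi> ` C) = {}"
proof (rule ccontr)
  have inj: "\<phi> y = \<phi> z \<Longrightarrow> y = z" for y z by (simp add: \<phi>_def)
  have opi: "open (inside C)" using C by (simp add: open_inside compact_imp_closed)
  let ?S = "\<phi> ` (inside C - {w})"
  assume "?S \<inter> inside (\<phi> ` C) \<noteq> {}"
  then obtain u where u: "u \<in> ?S" "u \<in> inside (\<phi> ` C)" by blast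
  have "connected (inside C - {w})" by (rule connected_open_delete[OF opi con]) simp
  then have conS: "connected ?S"
    by (intro connected_continuous_image) (auto simp: \<phi>_def intro!: continuous_intros)
  have "?S \<inter> \<phi> ` C = {}"
  proof (rule ccontr)
    assume "\<not> ?thesis"
    then obtain y z where "y \<in> inside C" "z \<in> C" "\<phi> y = \<phi> z" by blast
    then show False using inj inside_no_overlap[of C] by blast
  qed
  then have "?S \<subseteq> connected_component_set (- \<phi> ` C) u"
    using u conS by (intro connected_component_maximal) auto
  then have "bounded ?S" using u unfolding inside_def by (auto intro: bounded_subset)
  then obtain M where M: "M > 0" "\<And>s. s \<in> ?S \<Longrightarrow> norm s \<le> M" by (auto simp: bounded_pos)
  obtain \<epsilon> where e: "\<epsilon> > 0" "ball w \<epsilon> \<subseteq> inside C" using opi w open_contains_ball by blast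
  \<comment> \<open>The point \<open>w + \<delta>\<close> is still inside, and its image has norm
    \<open>1 / \<delta>\<close>, at least \<open>M + 1\<close>.\<close>
  define \<delta> where "\<delta> = min (\<epsilon> / 2) (inverse (M + 1))"
  have d: "\<delta> > 0" "\<delta> < \<epsilon>" "\<delta> \<le> inverse (M + 1)" using e M by (auto simp: \<delta>_def min_def)
  have "w + of_real \<delta> \<in> inside C" using e d by (intro subsetD[OF e(2)]) (auto simp: dist_norm)
  then have "\<phi> (w + of_real \<delta>) \<in> ?S" using d by auto
  then have "norm (\<phi> (w + of_real \<delta>)) \<le> M" by (rule M(2))
  then have "inverse \<delta> \<le> M" using d by (simp add: \<phi>_def norm_inverse)
  moreover have "M + 1 \<le> inverse \<delta>"
    using d M le_imp_inverse_le[of \<delta> "inverse (M + 1)"] by simp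
  ultimately show False by simp
qed

section \<open>Both sides of a cycle in a block\<close>

context plane_graph
begin

lemma plane_graph_subgraph:
  assumes "V' \<subseteq> V" "E' \<subseteq> E" "\<And>e. e \<in> E' \<Longrightarrow> e \<subseteq> V'"
  shows "plane_graph V' E' p \<gamma>"
proof
  show "finite V'" by (rule finite_subset[OF assms(1) finite_V])
  show "inj_on p V'" by (rule inj_on_subset[OF inj_p assms(1)])
  fix e assume e: "e \<in> E'"
  then have eE: "e \<in> E" using assms by blast
  show "e \<subseteq> V'" "card e = 2" "arc (\<gamma> e)" "{pathstart (\<gamma> e), pathfinish (\<gamma> e)} = p ` e"
    using e eE assms edge_card arc_edge edge_ends by auto
  show "path_image (\<gamma> e) \<inter> p ` V' = p ` e"
    using edge_vertices[OF eE] assms(1) assms(3)[OF e] by blast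
  fix f assume "f \<in> E'" "e \<noteq> f"
  then show "path_image (\<gamma> e) \<inter> path_image (\<gamma> f) \<subseteq> p ` (e \<inter> f)"
    using edge_edge[OF eE] assms(2) by blast
qed

lemma cycle_loop:
  assumes Z: "cycle_set Z" "Z \<subseteq> E"
  obtains c where "simple_path c" "pathfinish c = pathstart c" "path_image c = drawn Z"
proof -
  obtain r where r: "3 \<le> length r" "distinct r" "Z = insert {last r, hd r} (path_edges r)"
    using Z unfolding cycle_set_def by blast
  then obtain x y s where xy: "r = x # y # s" by (cases r rule: path_edges.cases) auto
  then have "x \<in> \<Union>Z" "y \<in> \<Union>Z" "x \<noteq> y" using r by auto
  then obtain q1 q2 where q: "path_in Z x q1 y" "path_in Z x q2 y" "Z = path_edges q1 \<union> path_edges q2"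
    "set q1 \<inter> set q2 = {x, y}" "path_edges q1 \<inter> path_edges q2 = {}"
    using cycle_set_split[OF Z(1)] by metis
  then have qE: "path_in E x q1 y" "path_in E x q2 y" using Z by (auto simp: path_in_def)
  obtain c1 c2 where
    c1: "arc c1" "pathstart c1 = p x" "pathfinish c1 = p y" "path_image c1 = drawn (path_edges q1)" and
    c2: "arc c2" "pathstart c2 = p x" "pathfinish c2 = p y" "path_image c2 = drawn (path_edges q2)"
    using arc_of_path qE \<open>x \<noteq> y\<close> by metis
  have "path_image c1 \<inter> path_image c2 \<subseteq> {p x, p y}"
    using drawn_paths_Int[OF _ _ q(4,5)] qE c1(4) c2(4) by (auto simp: path_in_def)
  then have "simple_path (c1 +++ reversepath c2)"
    using c1 c2 by (simp add: simple_path_join_loop_eq arc_reversepath)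
  moreover have "path_image (c1 +++ reversepath c2) = drawn Z"
    using c1 c2 q(3) by (simp add: path_image_join drawn_Un)
  ultimately show ?thesis using that c1 c2 by simp
qed

text \<open>Provides the centre of inversion. Finitely many arcs and points are closed without
  interior, so they cannot cover the nonempty open inside.\<close>

lemma exists_point_off_drawing:
  assumes Z: "cycle_set Z" "Z \<subseteq> E"
  obtains w where "w \<in> inside (drawn Z)" "w \<notin> drawn E" "w \<notin> p ` V"
proof -
  obtain c where c: "simple_path c" "pathfinish c = pathstart c" "path_image c = drawn Z"
    using cycle_loop[OF Z] .
  have I: "inside (drawn Z) \<noteq> {}" "open (inside (drawn Z))"
    using Jordan_inside_outside[OF c(1,2)] c(3) by auto
  have "interior (drawn E) = {}"
    unfolding drawn_def using finite_E arc_edge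
    by (intro interior_Union_closed_empty) (auto simp: interior_arc_image closed_arc_image)
  then have "interior (drawn E \<union> p ` V) = {}"
    using finite_V interior_closed_Un_empty_interior[of "p ` V" "drawn E"]
    by (simp add: Un_commute finite_imp_closed empty_interior_finite
        interior_closed_Un_empty_interior compact_imp_closed compact_drawn)
  then have "\<not> inside (drawn Z) \<subseteq> drawn E \<union> p ` V"
    using I interior_maximal[of "inside (drawn Z)"] by blast
  then show ?thesis using that by blast
qed

lemma plane_graph_inversion:
  assumes w: "w \<notin> drawn E" "w \<notin> p ` V"
  defines "\<phi> \<equiv> \<lambda>z. inverse (z - w)"
  shows "plane_graph V E (\<phi> \<circ> p) (\<lambda>e. \<phi> \<circ> \<gamma> e)"
proof
  have inj: "inj \<phi>" by (auto simp: \<phi>_def inj_def)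
  show "finite V" by (rule finite_V)
  show "inj_on (\<phi> \<circ> p) V" using inj_p inj by (simp add: comp_inj_on inj_on_subset)
  fix e assume e: "e \<in> E"
  show "e \<subseteq> V" "card e = 2" using edge_subset edge_card e by auto
  have "w \<notin> path_image (\<gamma> e)" using w e by (auto simp: drawn_def)
  then have cont: "continuous_on (path_image (\<gamma> e)) \<phi>"
    unfolding \<phi>_def by (intro continuous_intros) auto
  show "arc (\<phi> \<circ> \<gamma> e)"
    using arc_edge[OF e] cont inj
    by (auto simp: arc_def path_continuous_image comp_inj_on inj_on_subset)
  have "{pathstart (\<phi> \<circ> \<gamma> e), pathfinish (\<phi> \<circ> \<gamma> e)} = \<phi> ` {pathstart (\<gamma> e), pathfinish (\<gamma> e)}"
    by (simp add: pathstart_compose pathfinish_compose)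
  then show "{pathstart (\<phi> \<circ> \<gamma> e), pathfinish (\<phi> \<circ> \<gamma> e)} = (\<phi> \<circ> p) ` e"
    using edge_ends[OF e] by (simp add: image_comp)
  show "path_image (\<phi> \<circ> \<gamma> e) \<inter> (\<phi> \<circ> p) ` V = (\<phi> \<circ> p) ` e"
    using edge_vertices[OF e]
    unfolding path_image_compose image_comp[symmetric] image_Int[OF inj, symmetric] by simp
  fix f assume "f \<in> E" "e \<noteq> f"
  then show "path_image (\<phi> \<circ> \<gamma> e) \<inter> path_image (\<phi> \<circ> \<gamma> f) \<subseteq> (\<phi> \<circ> p) ` (e \<inter> f)"
    using edge_edge[OF e]
    unfolding path_image_compose image_comp[symmetric] image_Int[OF inj, symmetric]
    by (simp add: image_mono)
qed

text \<open>The edges outside a cycle are the edges inside it after an inversion centred at a point inside.\<close>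

lemma not_splittable_density:
  assumes ns: "\<not> splittable E" and k: "2 \<le> k"
    and girth: "\<And>Z. \<lbrakk>cycle_set Z; Z \<subseteq> E\<rbrakk> \<Longrightarrow> k \<le> card Z"
    and Z: "cycle_set Z" "Z \<subseteq> E"
  shows "(k - 2) * card E + k \<le> k * card V"
proof -
  obtain w where w: "w \<in> inside (drawn Z)" "w \<notin> drawn E" "w \<notin> p ` V"
    using exists_point_off_drawing[OF Z] .
  define \<phi> where "\<phi> = (\<lambda>z. inverse (z - w))"
  have inj: "inj \<phi>" by (auto simp: \<phi>_def inj_def)
  interpret inv: plane_graph V E "\<phi> \<circ> p" "\<lambda>e. \<phi> \<circ> \<gamma> e"
    unfolding \<phi>_def by (rule plane_graph_inversion[OF w(2,3)])
  obtain c where c: "simple_path c" "pathfinish c = pathstart c" "path_image c = drawn Z"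
    using cycle_loop[OF Z] .
  have con: "connected (inside (drawn Z))"
    using Jordan_inside_outside[OF c(1,2)] c(3) by auto
  have dr: "inv.drawn Z = \<phi> ` drawn Z"
    by (auto simp: inv.drawn_def drawn_def path_image_compose)
  have oe: "inv.open_edge e = \<phi> ` open_edge e" for e
    unfolding inv.open_edge_def open_edge_def path_image_compose
    by (simp add: image_set_diff[OF inj] image_comp)
  have out: "\<phi> ` outside (drawn Z) \<subseteq> inside (\<phi> ` drawn Z)"
    unfolding \<phi>_def by (rule inversion_outside_subset_inside[OF compact_drawn[OF Z(2)] w(1)])
  have inn: "\<phi> ` (inside (drawn Z) - {w}) \<inter> inside (\<phi> ` drawn Z) = {}"
    unfolding \<phi>_def by (rule inversion_inside_disjoint_inside[OF compact_drawn[OF Z(2)] con w(1)])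
  have "E \<subseteq> Z \<union> edges_inside Z \<union> inv.edges_inside Z"
  proof
    fix e assume e: "e \<in> E"
    show "e \<in> Z \<union> edges_inside Z \<union> inv.edges_inside Z"
    proof (cases "e \<in> Z")
      case False
      obtain z where z: "z \<in> open_edge e" using open_edge_nonempty[OF e] by blast
      note disj = open_edge_drawn[OF Z(2) e False]
      then have "z \<in> inside (drawn Z) \<or> z \<in> outside (drawn Z)"
        using z inside_Un_outside[of "drawn Z"] by blast
      then show ?thesis
      proof
        assume "z \<in> inside (drawn Z)"
        then show ?thesis using edges_insideI[OF Z(2) e False z] by simp
      next
        assume "z \<in> outside (drawn Z)"
        then have "open_edge e \<subseteq> outside (drawn Z)"
          using outside_connected_subset[OF connected_open_edge[OF e] disj z] by simp
        then have "inv.open_edge e \<subseteq> inside (inv.drawn Z)" using out unfolding oe dr by blast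
        then show ?thesis using e by (simp add: inv.edges_inside_def)
      qed
    qed simp
  qed
  moreover have finM: "finite (edges_inside Z)" "finite (inv.edges_inside Z)" "finite Z"
    using finite_E Z(2) by (auto simp: edges_inside_def inv.edges_inside_def intro: finite_subset)
  ultimately have "card E \<le> card (Z \<union> edges_inside Z \<union> inv.edges_inside Z)"
    by (intro card_mono) auto
  also have "\<dots> \<le> card Z + card (edges_inside Z) + card (inv.edges_inside Z)"
    by (meson card_Un_le add_le_mono1 le_trans)
  finally have m: "card E \<le> card Z + card (edges_inside Z) + card (inv.edges_inside Z)" .
  have finN: "finite (vertices_inside Z)" "finite (inv.vertices_inside Z)" "finite (\<Union>Z)"
    using finite_V Z(2) edge_subset
    by (auto simp: vertices_inside_def inv.vertices_inside_def intro: finite_subset[of "\<Union>Z" V])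
  have "\<Union>Z \<inter> vertices_inside Z = {}"
    using vertex_in_drawn[OF Z(2)] inside_no_overlap[of "drawn Z"] unfolding vertices_inside_def by blast
  moreover have "\<Union>Z \<inter> inv.vertices_inside Z = {}"
    using inv.vertex_in_drawn[OF Z(2)] inside_no_overlap[of "inv.drawn Z"]
    unfolding inv.vertices_inside_def by blast
  moreover have "vertices_inside Z \<inter> inv.vertices_inside Z = {}"
  proof (rule ccontr)
    assume "\<not> ?thesis"
    then obtain v where v: "v \<in> V" "p v \<in> inside (drawn Z)" "\<phi> (p v) \<in> inside (\<phi> ` drawn Z)"
      unfolding vertices_inside_def inv.vertices_inside_def dr by auto
    then have "p v \<noteq> w" using w by auto
    then show False using v inn by blast
  qed
  ultimately have "card (\<Union>Z \<union> vertices_inside Z \<union> inv.vertices_inside Z) =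
      card (\<Union>Z) + card (vertices_inside Z) + card (inv.vertices_inside Z)"
    using finN by (simp add: card_Un_disjoint Int_Un_distrib2)
  moreover have "\<Union>Z \<union> vertices_inside Z \<union> inv.vertices_inside Z \<subseteq> V"
    using Z(2) edge_subset by (auto simp: vertices_inside_def inv.vertices_inside_def)
  ultimately have n: "card Z + card (vertices_inside Z) + card (inv.vertices_inside Z) \<le> card V"
    using card_mono[OF finite_V] cycle_set_Union_card(2)[OF Z(1)] by metis
  obtain j where j: "k = j + 2" using k by (metis add.commute le_Suc_ex)
  have "j * card E \<le> j * (card Z + card (edges_inside Z) + card (inv.edges_inside Z))"
    using m by simp
  moreover have "(j + 2) * (card Z + card (vertices_inside Z) + card (inv.vertices_inside Z))
      \<le> (j + 2) * card V" using n by (rule mult_le_mono2)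
  \<comment> \<open>\<open>card Z\<close> enters both counts; with \<open>(k - 2) * card Z\<close>
    for the edges of the cycle this makes \<open>k * card Z\<close>, the share of its vertices. One
    of the two constants \<open>k\<close> is given away.\<close>
  ultimately show ?thesis
    using inside_count[OF ns k girth Z] inv.inside_count[OF ns k girth Z]
    unfolding j by (simp add: algebra_simps)
qed

end

text \<open>Two parts of a split contribute the constant \<open>2 k\<close>, and counting the shared
  vertex twice costs at most \<open>k\<close>, so \<open>k\<close> is left. Blocks without a cycle
  are single edges and are checked directly.\<close>

lemma plane_graph_density:
  assumes "plane_graph V E p \<gamma>" "2 \<le> k" "V \<noteq> {}"
    and "\<And>Z. \<lbrakk>cycle_set Z; Z \<subseteq> E\<rbrakk> \<Longrightarrow> k \<le> card Z"
  shows "(k - 2) * card E + k \<le> k * card V"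
  using assms
proof (induction "card E" arbitrary: V E rule: less_induct)
  case less
  interpret plane_graph V E p \<gamma> by fact
  have V1: "1 \<le> card V" using less.prems finite_V by (simp add: Suc_le_eq card_gt_0_iff)
  obtain j where j: "k = j + 2" using less.prems by (metis add.commute le_Suc_ex)
  show ?case
  proof (cases "splittable E")
    case True
    then obtain E1 E2 x where E: "E = E1 \<union> E2" "E1 \<inter> E2 = {}" "E1 \<noteq> {}" "E2 \<noteq> {}"
      "\<Union>E1 \<inter> \<Union>E2 \<subseteq> {x}" unfolding splittable_def by blast
    have fin: "finite E1" "finite E2" using finite_E E by auto
    have UV: "\<Union>E1 \<subseteq> V" "\<Union>E2 \<subseteq> V" using E(1) edge_subset by blast+
    note finU = finite_subset[OF UV(1) finite_V] finite_subset[OF UV(2) finite_V]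
    have ne: "\<Union>E1 \<noteq> {}" "\<Union>E2 \<noteq> {}"
    proof -
      obtain e f where ef: "e \<in> E1" "f \<in> E2" using E(3,4) by blast
      then have "e \<noteq> {}" "f \<noteq> {}" using E(1) edge_card[of e] edge_card[of f] by auto
      then show "\<Union>E1 \<noteq> {}" "\<Union>E2 \<noteq> {}" using ef by blast+
    qed
    have cE: "card E = card E1 + card E2" using E fin by (simp add: card_Un_disjoint)
    have pos: "0 < card E1" "0 < card E2" using E fin by (auto simp: card_gt_0_iff)
    have "plane_graph (\<Union>E1) E1 p \<gamma>" "plane_graph (\<Union>E2) E2 p \<gamma>"
      using E(1) by (auto intro!: plane_graph_subgraph[OF UV(1)] plane_graph_subgraph[OF UV(2)])
    moreover have "k \<le> card Z" if "cycle_set Z" "Z \<subseteq> E1 \<or> Z \<subseteq> E2" for Z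
      using that E(1) less.prems(4)[of Z] by blast
    ultimately have IH: "(k - 2) * card E1 + k \<le> k * card (\<Union>E1)"
        "(k - 2) * card E2 + k \<le> k * card (\<Union>E2)"
      using less.hyps[of E1 "\<Union>E1"] less.hyps[of E2 "\<Union>E2"] less.prems(2) ne cE pos by simp_all
    have "card (\<Union>E1) + card (\<Union>E2) = card (\<Union>E1 \<union> \<Union>E2) + card (\<Union>E1 \<inter> \<Union>E2)"
      by (rule card_Un_Int[OF finU])
    also have "\<dots> \<le> card V + 1"
      using UV finite_V card_mono[OF _ E(5)] by (intro add_mono card_mono) auto
    finally have "k * (card (\<Union>E1) + card (\<Union>E2)) \<le> k * (card V + 1)" by (rule mult_le_mono2)
    then show ?thesis using IH cE by (simp add: algebra_simps)
  next
    case ns: False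
    show ?thesis
    proof (cases "E = {} \<or> (\<exists>e. E = {e})")
      case True
      then show ?thesis
      proof
        assume "E = {}" then show ?thesis using V1 by (simp add: Suc_le_eq)
      next
        assume "\<exists>e. E = {e}"
        then obtain e where e: "E = {e}" by blast
        then have "2 \<le> card V" using edge_card[of e] card_mono[OF finite_V edge_subset[of e]] by simp
        then have "(j + 2) * 2 \<le> (j + 2) * card V" by (rule mult_le_mono2)
        then show ?thesis using e j by simp
      qed
    next
      case False
      then obtain e where e: "e \<in> E" "E \<noteq> {e}" by blast
      obtain Z where Z: "cycle_set Z" "Z \<subseteq> E"
        by (rule not_splittable_cycle[OF edge_card ns e])
      show ?thesis by (rule not_splittable_density[OF ns less.prems(2) _ Z]) (rule less.prems(4))
    qed
  qed
qed

lemma planar_density: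
  fixes V :: "'a set"
  assumes g: "simple_graph V E" "planar V E" and "S \<subseteq> V" "S \<noteq> {}" "2 \<le> k"
    and girth: "\<And>vs. is_cycle E vs \<Longrightarrow> k \<le> length vs"
  shows "(k - 2) * card {e \<in> E. e \<subseteq> S} < k * card S"
proof -
  obtain p :: "'a \<Rightarrow> complex" and \<gamma> :: "'a set \<Rightarrow> real \<Rightarrow> complex" where
     p: "inj_on p V" and
     E: "\<forall>e\<in>E. arc (\<gamma> e) \<and> {pathstart (\<gamma> e), pathfinish (\<gamma> e)} = p ` e \<and>
               path_image (\<gamma> e) \<inter> p ` V = p ` e" and
     EE: "\<forall>e\<in>E. \<forall>f\<in>E. e \<noteq> f \<longrightarrow> path_image (\<gamma> e) \<inter> path_image (\<gamma> f) \<subseteq> p ` (e \<inter> f)"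
    using g unfolding planar_def by blast
  interpret plane_graph V E p \<gamma>
    using g p E EE by unfold_locales (auto simp: simple_graph_def)
  have "plane_graph S {e \<in> E. e \<subseteq> S} p \<gamma>" using assms by (intro plane_graph_subgraph) auto
  then have "(k - 2) * card {e \<in> E. e \<subseteq> S} + k \<le> k * card S"
  proof (rule plane_graph_density)
    fix Z assume "cycle_set Z" "Z \<subseteq> {e \<in> E. e \<subseteq> S}"
    then show "k \<le> card Z" using cycle_set_card_ge[of Z E k] girth by blast
  qed fact+
  then show ?thesis using assms by linarith
qed

section \<open>Sparse subcubic graphs\<close>

definition nbrs :: "'a set set \<Rightarrow> 'a \<Rightarrow> 'a set" where
  "nbrs E v = {u. {v, u} \<in> E}"

definition induced :: "'a set set \<Rightarrow> 'a set \<Rightarrow> 'a set set" where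
  "induced E S = {e \<in> E. e \<subseteq> S}"

text \<open>All that the colouring arguments take from planarity and girth. Quantifying over every
  \<open>S\<close> makes it pass to induced subgraphs without a drawing.\<close>

definition sparse_graph :: "nat \<Rightarrow> 'a set \<Rightarrow> 'a set set \<Rightarrow> bool" where
  "sparse_graph k V E \<longleftrightarrow> simple_graph V E \<and> subcubic V E \<and>
     (\<forall>vs. is_cycle E vs \<longrightarrow> k \<le> length vs) \<and>
     (\<forall>S\<subseteq>V. S \<noteq> {} \<longrightarrow> (k - 2) * card (induced E S) < k * card S)"

lemma nbrs_sym: "u \<in> nbrs E v \<longleftrightarrow> v \<in> nbrs E u"
  by (simp add: nbrs_def insert_commute)

lemma induced_induced: "S \<subseteq> T \<Longrightarrow> induced (induced E T) S = induced E S"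
  by (auto simp: induced_def)

locale subcubic_graph =
  fixes V :: "'a set" and E :: "'a set set"
  assumes simple: "simple_graph V E" and subcubic: "subcubic V E"
begin

lemma finite_V: "finite V" and finite_E: "finite E"
  using simple by (auto simp: simple_graph_def intro: finite_subset[of E "Pow V"])

lemma edge_in: "{u, v} \<in> E \<Longrightarrow> u \<in> V \<and> v \<in> V \<and> u \<noteq> v"
  using simple unfolding simple_graph_def by (cases "u = v") auto

lemma edgeE:
  assumes "e \<in> E" obtains u v where "e = {u, v}" "u \<noteq> v"
  using assms simple unfolding simple_graph_def card_2_iff by metis

lemma nbrs_subset: "nbrs E v \<subseteq> V" and nbrs_irrefl: "v \<notin> nbrs E v"
  using edge_in[of v] edge_in[of v v] unfolding nbrs_def by blast+

lemma finite_nbrs [simp]: "finite (nbrs E v)"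
  using nbrs_subset finite_V finite_subset by metis

lemma degree_eq: "degree E v = card (nbrs E v)"
proof -
  have "bij_betw (\<lambda>u. {v, u}) (nbrs E v) {e \<in> E. v \<in> e}"
    unfolding bij_betw_def
  proof
    show "inj_on (\<lambda>u. {v, u}) (nbrs E v)" by (auto simp: inj_on_def doubleton_eq_iff)
    have "e \<in> (\<lambda>u. {v, u}) ` nbrs E v" if e: "e \<in> E" "v \<in> e" for e
    proof -
      obtain a b where "e = {a, b}" using edgeE[OF e(1)] .
      then show ?thesis using e by (auto simp: nbrs_def insert_commute)
    qed
    then show "(\<lambda>u. {v, u}) ` nbrs E v = {e \<in> E. v \<in> e}" by (auto simp: nbrs_def)
  qed
  then show ?thesis by (simp add: degree_def bij_betw_same_card)
qed

lemma card_nbrs_le: "card (nbrs E v) \<le> 3"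
proof (cases "v \<in> V")
  case True
  then show ?thesis using subcubic by (simp add: subcubic_def degree_eq)
next
  case False
  then have "nbrs E v = {}" using edge_in[of v] by (auto simp: nbrs_def)
  then show ?thesis by simp
qed

lemma handshake: "(\<Sum>v\<in>V. card (nbrs E v)) = 2 * card E"
proof -
  have "(\<Sum>v\<in>V. card (nbrs E v)) = (\<Sum>v\<in>V. \<Sum>e\<in>E. if v \<in> e then 1 else 0)"
    unfolding degree_eq[symmetric] degree_def using finite_E by (simp add: sum.If_cases Int_def)
  also have "\<dots> = (\<Sum>e\<in>E. \<Sum>v\<in>V. if v \<in> e then 1 else 0)" by (rule sum.swap)
  also have "\<dots> = (\<Sum>e\<in>E. 2)"
  proof (rule sum.cong)
    fix e assume "e \<in> E"
    then have "V \<inter> e = e" "card e = 2" using simple by (auto simp: simple_graph_def)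
    then show "(\<Sum>v\<in>V. if v \<in> e then 1 else 0) = (2::nat)"
      using finite_V by (simp add: sum.If_cases)
  qed simp
  finally show ?thesis by simp
qed

lemma subcubic_graph_induced:
  assumes "S \<subseteq> V" shows "subcubic_graph S (induced E S)"
proof
  show "simple_graph S (induced E S)"
    using simple assms finite_subset by (auto simp: simple_graph_def induced_def)
  have "degree (induced E S) v \<le> degree E v" for v
    unfolding degree_def using finite_E by (intro card_mono) (auto simp: induced_def)
  then show "subcubic S (induced E S)"
    using subcubic assms unfolding subcubic_def by (meson le_trans subsetD)
qed

section \<open>Discharging\<close>

definition discharge :: "'a \<Rightarrow> nat" where
  "discharge x = (if card (nbrs E x) \<noteq> 2 then 0
     else if \<exists>y\<in>nbrs E x. card (nbrs E y) = 2 then 2 else 1)"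

text \<open>Every 3-vertex sends \<^term>\<open>discharge x\<close> to each neighbour \<^term>\<open>x\<close>, so that
  every 2-vertex receives 2 in total.\<close>

lemma discharging:
  assumes deg: "\<And>v. v \<in> V \<Longrightarrow> 2 \<le> card (nbrs E v)"
    and two: "\<And>x y z. \<lbrakk>nbrs E x = {y, z}; y \<noteq> z; card (nbrs E y) = 2\<rbrakk> \<Longrightarrow> card (nbrs E z) \<noteq> 2"
    and three: "\<And>v. card (nbrs E v) = 3 \<Longrightarrow> sum discharge (nbrs E v) \<le> t"
  shows "2 * card {v \<in> V. card (nbrs E v) = 2} \<le> t * card {v \<in> V. card (nbrs E v) = 3}"
proof -
  let ?V2 = "{v \<in> V. card (nbrs E v) = 2}" and ?V3 = "{v \<in> V. card (nbrs E v) = 3}"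
  have fin: "finite ?V2" "finite ?V3" using finite_V by auto
  have nV: "card (nbrs E y) = 2 \<or> card (nbrs E y) = 3" if "y \<in> V" for y
    using deg[OF that] card_nbrs_le[of y] by linarith
  have recv: "2 \<le> (\<Sum>v\<in>?V3. if x \<in> nbrs E v then discharge x else 0)" if x: "x \<in> ?V2" for x
  proof -
    obtain y z where yz: "nbrs E x = {y, z}" "y \<noteq> z" using x by (auto simp: card_2_iff)
    have "y \<in> V" "z \<in> V" using yz nbrs_subset[of x] by auto
    note yz3 = nV[OF this(1)] nV[OF this(2)]
    have "(\<Sum>v\<in>?V3. if x \<in> nbrs E v then discharge x else 0) = card (?V3 \<inter> nbrs E x) * discharge x"
      using fin nbrs_sym[of x E] by (simp add: sum.If_cases Int_def)
    \<comment> \<open>A 2-vertex with a 2-neighbour has, by \<open>two\<close>, one 3-neighbour,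
      which sends 2; any other has two 3-neighbours that send 1 each.\<close>
    moreover have "card (?V3 \<inter> nbrs E x) * discharge x \<ge> 2"
    proof (cases "card (nbrs E y) = 2 \<or> card (nbrs E z) = 2")
      case True
      then have "discharge x = 2" using x yz by (auto simp: discharge_def)
      moreover have "card (nbrs E y) = 3 \<or> card (nbrs E z) = 3"
        using two[OF yz] yz3 by blast
      then have "?V3 \<inter> nbrs E x \<noteq> {}" using yz \<open>y \<in> V\<close> \<open>z \<in> V\<close> by auto
      then have "1 \<le> card (?V3 \<inter> nbrs E x)" by (simp add: Suc_le_eq card_gt_0_iff)
      ultimately show ?thesis by simp
    next
      case False
      then have "?V3 \<inter> nbrs E x = {y, z}" using yz \<open>y \<in> V\<close> \<open>z \<in> V\<close> yz3 by auto
      moreover have "discharge x = 1" using x yz False by (auto simp: discharge_def)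
      ultimately show ?thesis using yz by simp
    qed
    ultimately show ?thesis by simp
  qed
  have "2 * card ?V2 = (\<Sum>x\<in>?V2. 2)" by simp
  also have "\<dots> \<le> (\<Sum>x\<in>?V2. \<Sum>v\<in>?V3. if x \<in> nbrs E v then discharge x else 0)"
    by (intro sum_mono recv)
  also have "\<dots> = (\<Sum>v\<in>?V3. \<Sum>x\<in>?V2. if x \<in> nbrs E v then discharge x else 0)" by (rule sum.swap)
  also have "\<dots> \<le> (\<Sum>v\<in>?V3. t)"
  proof (rule sum_mono)
    fix v assume v: "v \<in> ?V3"
    have "(\<Sum>x\<in>?V2. if x \<in> nbrs E v then discharge x else 0) = sum discharge (?V2 \<inter> nbrs E v)"
      using fin by (simp add: sum.If_cases Int_def)
    also have "\<dots> \<le> sum discharge (nbrs E v)" by (intro sum_mono2) auto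
    also have "\<dots> \<le> t" using three v by simp
    finally show "(\<Sum>x\<in>?V2. if x \<in> nbrs E v then discharge x else 0) \<le> t" .
  qed
  finally show ?thesis by (simp add: mult.commute)
qed

end

lemma sparse_graph_induced:
  assumes "sparse_graph k V E" "S \<subseteq> V"
  shows "sparse_graph k S (induced E S)"
proof -
  interpret subcubic_graph V E using assms by unfold_locales (auto simp: sparse_graph_def)
  interpret S: subcubic_graph S "induced E S" by (rule subcubic_graph_induced) fact
  have "is_cycle E vs" if "is_cycle (induced E S) vs" for vs
    using that by (auto simp: is_cycle_def induced_def)
  moreover have "(k - 2) * card (induced (induced E S) T) < k * card T" if "T \<subseteq> S" "T \<noteq> {}" for T
    using assms that unfolding sparse_graph_def by (simp add: induced_induced)
  ultimately show ?thesis
    using assms S.simple S.subcubic by (auto simp: sparse_graph_def)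
qed

text \<open>Let \<open>n2\<close> and \<open>n3\<close> count the vertices of degree 2 and 3. By the
  handshake lemma sparsity reads \<open>(k - 2) (2 n2 + 3 n3) < 2 k (n2 + n3)\<close>, that is
  \<open>(k - 6) n3 < 4 n2\<close>, whereas discharging gives \<open>4 n2 <= 2 t n3\<close>. Hence
  the threshold \<open>6 + 2 t\<close>.\<close>

lemma sparse_graph_reducible:
  assumes sp: "sparse_graph k V E" and ne: "V \<noteq> {}" and t: "6 + 2 * t \<le> k"
    and deg: "\<And>v. v \<in> V \<Longrightarrow> 2 \<le> card (nbrs E v)"
    and two: "\<And>x y z. \<lbrakk>nbrs E x = {y, z}; y \<noteq> z; card (nbrs E y) = 2\<rbrakk> \<Longrightarrow> card (nbrs E z) \<noteq> 2"
    and three: "\<And>v. card (nbrs E v) = 3 \<Longrightarrow> sum (subcubic_graph.discharge E) (nbrs E v) \<le> t"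
  shows False
proof -
  interpret subcubic_graph V E using sp by unfold_locales (auto simp: sparse_graph_def)
  let ?V2 = "{v \<in> V. card (nbrs E v) = 2}" and ?V3 = "{v \<in> V. card (nbrs E v) = 3}"
  have V: "V = ?V2 \<union> ?V3"
  proof
    show "V \<subseteq> ?V2 \<union> ?V3"
    proof
      fix v assume "v \<in> V"
      then show "v \<in> ?V2 \<union> ?V3" using deg[of v] card_nbrs_le[of v] by auto
    qed
  qed auto
  have cV: "card V = card ?V2 + card ?V3"
    using finite_V by (subst V, subst card_Un_disjoint) auto
  have "2 * card E = sum (\<lambda>v. card (nbrs E v)) (?V2 \<union> ?V3)" using handshake V by simp
  also have "\<dots> = sum (\<lambda>v. card (nbrs E v)) ?V2 + sum (\<lambda>v. card (nbrs E v)) ?V3"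
    using finite_V by (intro sum.union_disjoint) auto
  also have "\<dots> = 2 * card ?V2 + 3 * card ?V3" by simp
  finally have cE: "2 * card E = 2 * card ?V2 + 3 * card ?V3" .
  have "induced E V = E" using simple by (auto simp: induced_def simple_graph_def)
  then have d: "(k - 2) * card E < k * card V" using sp ne unfolding sparse_graph_def by auto
  obtain j where j: "k = j + 6 + 2 * t" using t by (metis add.commute add.left_commute le_Suc_ex)
  have "2 * card ?V2 \<le> t * card ?V3"
  proof (rule discharging)
    show "2 \<le> card (nbrs E v)" if "v \<in> V" for v by (rule deg[OF that])
    show "card (nbrs E z) \<noteq> 2" if "nbrs E x = {y, z}" "y \<noteq> z" "card (nbrs E y) = 2" for x y z
      by (rule two[OF that])
    show "sum discharge (nbrs E v) \<le> t" if "card (nbrs E v) = 3" for v by (rule three[OF that])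
  qed
  then have "4 * card ?V2 \<le> 2 * t * card ?V3 + j * card ?V3" by simp
  moreover have "(k - 2) * (2 * card E) < 2 * (k * card V)" using d by simp
  ultimately show False unfolding cE cV j by (simp add: algebra_simps)
qed

text \<open>\<open>P\<close> takes the vertex set as well, because full colorings also colour
  vertices. Arbitrary nonempty sets \<open>D\<close> may be deleted, so that a configuration goes in
  one step.\<close>

lemma minimal_sparse_graph:
  assumes "sparse_graph k V E" "\<not> P V E"
  obtains V' E' where "sparse_graph k V' E'" "\<not> P V' E'"
    "\<And>D. \<lbrakk>D \<subseteq> V'; D \<noteq> {}\<rbrakk> \<Longrightarrow> P (V' - D) (induced E' (V' - D))"
proof -
  have "\<exists>V' E'. sparse_graph k V' E' \<and> \<not> P V' E' \<and>
    (\<forall>D\<subseteq>V'. D \<noteq> {} \<longrightarrow> P (V' - D) (induced E' (V' - D)))"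
    using assms
  proof (induction "card V" arbitrary: V E rule: less_induct)
    case less
    show ?case
    proof (cases "\<forall>D\<subseteq>V. D \<noteq> {} \<longrightarrow> P (V - D) (induced E (V - D))")
      case True
      then show ?thesis using less.prems by blast
    next
      case False
      then obtain D where D: "D \<subseteq> V" "D \<noteq> {}" "\<not> P (V - D) (induced E (V - D))" by blast
      have "finite V" using less.prems by (simp add: sparse_graph_def simple_graph_def)
      then have "card (V - D) < card V" using D by (intro psubset_card_mono) auto
      then show ?thesis
        using less.hyps[of "V - D" "induced E (V - D)"] D(3) sparse_graph_induced[OF less.prems(1)]
        by blast
    qed
  qed
  then show ?thesis using that by blast
qed

section \<open>Greedy reductions\<close>

text \<open>Taking \<open>d = a\<close> gives the triangle, so paths and triangles need no separate
  treatment.\<close>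

definition conflict :: "'a set set \<Rightarrow> 'a set \<Rightarrow> 'a set \<Rightarrow> bool" where
  "conflict E e f \<longleftrightarrow> (\<exists>a b c d. e = {a, b} \<and> f = {c, d} \<and> {a, b} \<in> E \<and> {b, c} \<in> E \<and> {c, d} \<in> E \<and>
     a \<noteq> c \<and> b \<noteq> d)"

text \<open>Only \<open>F\<close> is coloured, but conflicts are taken in the whole graph, so that
  edges can be added one at a time.\<close>

definition colorable :: "nat \<Rightarrow> 'a set set \<Rightarrow> 'a set set \<Rightarrow> bool" where
  "colorable k E F \<longleftrightarrow> (\<exists>c. c \<in> F \<rightarrow> {1..k} \<and> (\<forall>e\<in>F. \<forall>f\<in>F. conflict E e f \<longrightarrow> c e \<noteq> c f))"

text \<open>The edges in conflict with \<^term>\<open>{u, v}\<close> through an edge at \<^term>\<open>u\<close>.\<close>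

definition beyond :: "'a set set \<Rightarrow> 'a \<Rightarrow> 'a \<Rightarrow> 'a set set" where
  "beyond E u v = (\<Union>x\<in>nbrs E u - {v}. (\<lambda>y. {x, y}) ` (nbrs E x - {u}))"

lemma conflictI:
  "\<lbrakk>{a, b} \<in> E; {b, c} \<in> E; {c, d} \<in> E; a \<noteq> c; b \<noteq> d\<rbrakk> \<Longrightarrow> conflict E {a, b} {c, d}"
  unfolding conflict_def by blast

lemma conflictE:
  assumes "conflict E e f"
  obtains a b c d where "e = {a, b}" "f = {c, d}" "{a, b} \<in> E" "{b, c} \<in> E" "{c, d} \<in> E" "a \<noteq> c" "b \<noteq> d"
  using assms unfolding conflict_def by blast

lemma consecutive_conflict:
  assumes "consecutive E e\<^sub>1 e\<^sub>2 e\<^sub>3" shows "conflict E e\<^sub>1 e\<^sub>3"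
proof -
  obtain a b c d where e: "e\<^sub>1 = {a, b}" "e\<^sub>2 = {b, c}" "e\<^sub>3 = {c, d}"
    and d: "distinct [a, b, c, d] \<or> distinct [a, b, c] \<and> d = a"
    using assms unfolding consecutive_def by blast
  have "a \<noteq> c" "b \<noteq> d" using d by auto
  then show ?thesis
    using conflictI[of a b E c d] assms unfolding e consecutive_def by blast
qed

lemma injective_edge_coloring_if_colorable:
  assumes "colorable k E E" shows "\<exists>c. injective_edge_coloring E k c"
proof -
  obtain c where c: "c \<in> E \<rightarrow> {1..k}" "\<And>e f. \<lbrakk>e \<in> E; f \<in> E; conflict E e f\<rbrakk> \<Longrightarrow> c e \<noteq> c f"
    using assms unfolding colorable_def by blast
  have "c e\<^sub>1 \<noteq> c e\<^sub>3" if "consecutive E e\<^sub>1 e\<^sub>2 e\<^sub>3" for e\<^sub>1 e\<^sub>2 e\<^sub>3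
    using c(2) consecutive_conflict[OF that] that by (simp add: consecutive_def)
  then show ?thesis using c(1) unfolding injective_edge_coloring_def by blast
qed

lemma conflict_sym: "conflict E e f \<Longrightarrow> conflict E f e"
proof (erule conflictE)
  fix a b c d
  assume *: "e = {a, b}" "f = {c, d}" "{a, b} \<in> E" "{b, c} \<in> E" "{c, d} \<in> E" "a \<noteq> c" "b \<noteq> d"
  then show ?thesis using conflictI[of d c E b a] by (simp add: insert_commute)
qed

section \<open>Greedy extension and the reducible configurations for 5, 6 and 7 colours\<close>

context subcubic_graph
begin

lemma conflict_beyond:
  assumes "conflict E {u, v} f"
  shows "f \<in> beyond E u v \<union> beyond E v u"
proof -
  obtain a b c d where ab: "{u, v} = {a, b}" and f: "f = {c, d}" "{a, b} \<in> E" "{b, c} \<in> E"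
      "{c, d} \<in> E" "a \<noteq> c" "b \<noteq> d"
    using assms by (rule conflictE)
  have "f \<in> beyond E b a"
    unfolding beyond_def using f by (auto simp: nbrs_def)
  then show ?thesis using ab by (auto simp: doubleton_eq_iff)
qed

lemma conflict_irrefl: "\<not> conflict E e e"
proof
  assume "conflict E e e"
  then obtain a b c d where "e = {a, b}" "e = {c, d}" "{a, b} \<in> E" "{b, c} \<in> E" "{c, d} \<in> E"
      "a \<noteq> c" "b \<noteq> d" by (rule conflictE)
  then show False using edge_in[of b c] by (auto simp: doubleton_eq_iff)
qed

lemma beyond_subset: "beyond E u v \<subseteq> E"
  by (auto simp: beyond_def nbrs_def)

lemma card_beyond: "card (beyond E u v) \<le> (\<Sum>x\<in>nbrs E u - {v}. card (nbrs E x) - 1)"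
proof -
  have "card ((\<lambda>y. {x, y}) ` (nbrs E x - {u})) \<le> card (nbrs E x) - 1" if "x \<in> nbrs E u" for x
  proof -
    have "u \<in> nbrs E x" using that nbrs_sym by metis
    then have "card (nbrs E x - {u}) = card (nbrs E x) - 1" by simp
    then show ?thesis using card_image_le[of "nbrs E x - {u}" "\<lambda>y. {x, y}"] by simp
  qed
  then show ?thesis
    unfolding beyond_def by (intro order.trans[OF card_UN_le] sum_mono) auto
qed

lemma card_beyond_le:
  assumes "card (nbrs E u - {v}) \<le> n"
  shows "card (beyond E u v \<inter> F) \<le> 2 * n"
proof -
  have "card (beyond E u v \<inter> F) \<le> card (beyond E u v)"
    using finite_E beyond_subset by (intro card_mono) (auto intro: finite_subset)
  also have "\<dots> \<le> (\<Sum>x\<in>nbrs E u - {v}. card (nbrs E x) - 1)" by (rule card_beyond)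
  also have "\<dots> \<le> (\<Sum>x\<in>nbrs E u - {v}. 2)"
    using card_nbrs_le by (intro sum_mono) (simp add: diff_le_mono le_diff_conv)
  also have "\<dots> \<le> 2 * n" using assms by simp
  finally show ?thesis .
qed

lemma card_beyond_le_4: "v \<in> nbrs E u \<Longrightarrow> card (beyond E u v \<inter> F) \<le> 4"
  using card_beyond_le[of u v 2 F] card_nbrs_le[of u] by simp

lemma card_beyond_le_2: "nbrs E u \<subseteq> {v, a} \<Longrightarrow> card (beyond E u v \<inter> F) \<le> 2"
  using card_beyond_le[of u v 1 F] card_mono[of "{a}" "nbrs E u - {v}"] by auto

text \<open>Every edge in conflict with the new one lies beyond one of its ends, so at most
  \<open>m + n\<close> colours are forbidden.\<close>

lemma colorable_insert:
  assumes col: "colorable k E F" and e: "v \<in> nbrs E u"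
    and "card (beyond E u v \<inter> F) \<le> m" "card (beyond E v u \<inter> F) \<le> n" "m + n < k"
  shows "colorable k E (insert {u, v} F)"
proof -
  obtain c where c: "c \<in> F \<rightarrow> {1..k}" "\<And>e f. \<lbrakk>e \<in> F; f \<in> F; conflict E e f\<rbrakk> \<Longrightarrow> c e \<noteq> c f"
    using col unfolding colorable_def by blast
  let ?X = "beyond E u v \<inter> F \<union> beyond E v u \<inter> F"
  have fin: "finite ?X" using finite_E beyond_subset by (auto intro: finite_subset)
  have "card (c ` ?X) \<le> card ?X" using fin by (rule card_image_le)
  also have "\<dots> \<le> card (beyond E u v \<inter> F) + card (beyond E v u \<inter> F)" by (rule card_Un_le)
  finally have "card (c ` ?X) < card {1..k}" using assms by simp
  then have "\<not> {1..k} \<subseteq> c ` ?X" using fin card_mono[of "c ` ?X" "{1..k}"] by auto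
  then obtain j where j: "j \<in> {1..k}" "j \<notin> c ` ?X" by blast
  have new: "c f \<noteq> j" if "f \<in> F" "conflict E {u, v} f" for f
    using conflict_beyond[OF that(2)] that(1) j by blast
  have "(c({u, v} := j)) \<in> insert {u, v} F \<rightarrow> {1..k}" using c j by auto
  moreover have "(c({u, v} := j)) e \<noteq> (c({u, v} := j)) f"
    if "e \<in> insert {u, v} F" "f \<in> insert {u, v} F" "conflict E e f" for e f
    using that new[of e] new[of f] c(2)[of e f] conflict_irrefl[of e] conflict_sym[of E e f] conflict_sym[of E f e]
    by auto
  ultimately show ?thesis unfolding colorable_def by blast
qed

text \<open>Deleting vertices rather than edges matters: the middle edge of a conflict joins ends of
  two kept edges and is therefore kept too.\<close>

lemma colorable_induced:
  assumes "colorable k (induced E (V - D)) (induced E (V - D))"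
  shows "colorable k E (induced E (V - D))"
proof -
  have "conflict (induced E (V - D)) e f" if "e \<in> induced E (V - D)" "f \<in> induced E (V - D)" "conflict E e f" for e f
    using that(3)
  proof (rule conflictE)
    fix a b c d
    assume *: "e = {a, b}" "f = {c, d}" "{a, b} \<in> E" "{b, c} \<in> E" "{c, d} \<in> E" "a \<noteq> c" "b \<noteq> d"
    then have "{b, c} \<in> induced E (V - D)" using that by (auto simp: induced_def)
    then show ?thesis using * that by (auto intro: conflictI)
  qed
  then show ?thesis using assms unfolding colorable_def by blast
qed

lemma edges_cover:
  assumes "induced E (V - D) \<subseteq> F" "F \<subseteq> E" "\<And>d. d \<in> D \<Longrightarrow> \<forall>y\<in>nbrs E d. {d, y} \<in> F"
  shows "F = E"
proof
  show "E \<subseteq> F"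
  proof
    fix e assume e: "e \<in> E"
    obtain u v where uv: "e = {u, v}" using edgeE[OF e] .
    have "u \<in> V" "v \<in> V" using e uv edge_in by auto
    then consider "u \<in> D" | "v \<in> D" | "e \<in> induced E (V - D)" using e uv by (auto simp: induced_def)
    then show "e \<in> F"
    proof cases
      case 1 then show ?thesis using assms(3) e uv by (auto simp: nbrs_def)
    next
      case 2 then show ?thesis using assms(3)[of v] e uv by (auto simp: nbrs_def insert_commute)
    next
      case 3 then show ?thesis using assms(1) by blast
    qed
  qed
qed fact

lemma induced_subset: "induced E S \<subseteq> E"
  by (auto simp: induced_def)

lemma nbrs_mem: "y \<in> nbrs E x \<Longrightarrow> {x, y} \<in> E"
  by (auto simp: nbrs_def)

lemma not_in_induced: "x \<in> D \<Longrightarrow> {x, y} \<notin> induced E (V - D)" "x \<in> D \<Longrightarrow> {y, x} \<notin> induced E (V - D)"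
  by (auto simp: induced_def)

text \<open>A pendant edge has no conflict beyond its leaf and at most 4 beyond the other
  end.\<close>

lemma reduce_low_degree:
  assumes k: "5 \<le> k" and col: "colorable k (induced E (V - {u})) (induced E (V - {u}))"
    and u: "card (nbrs E u) \<le> 1"
  shows "colorable k E E"
proof -
  let ?F = "induced E (V - {u})"
  consider "nbrs E u = {}" | v where "nbrs E u = {v}"
    using u by (metis One_nat_def card_1_singletonE card_eq_0_iff finite_nbrs le_Suc_eq le_zero_eq)
  then show ?thesis
  proof cases
    case 1
    then have "?F = E" by (intro edges_cover[of "{u}"] induced_subset) auto
    then show ?thesis using colorable_induced[OF col] by simp
  next
    case (2 v)
    then have vu: "v \<in> nbrs E u" "u \<in> nbrs E v" using nbrs_sym[of v E u] by auto
    have b: "card (beyond E u v \<inter> ?F) \<le> 0" using 2 by (simp add: beyond_def)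
    have "colorable k E (insert {u, v} ?F)"
      by (rule colorable_insert[OF colorable_induced[OF col] vu(1) b card_beyond_le_4[OF vu(2)]])
        (use k in simp)
    moreover have "insert {u, v} ?F = E"
      using nbrs_mem[OF vu(1)] 2 induced_subset by (intro edges_cover[of "{u}"]) auto
    ultimately show ?thesis by simp
  qed
qed

text \<open>Each edge at \<open>u\<close> has at most 2 conflicts beyond \<open>u\<close> and 4
  beyond its other end.\<close>

lemma reduce_two_vertex:
  assumes col: "colorable 7 (induced E (V - {u})) (induced E (V - {u}))"
    and u: "nbrs E u = {v, w}"
  shows "colorable 7 E E"
proof -
  let ?F = "induced E (V - {u})"
  have n: "v \<in> nbrs E u" "w \<in> nbrs E u" "u \<in> nbrs E v" "u \<in> nbrs E w"
    using u nbrs_sym[of v E u] nbrs_sym[of w E u] by auto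
  have c1: "colorable 7 E (insert {u, v} ?F)"
    by (rule colorable_insert[OF colorable_induced[OF col] n(1) card_beyond_le_2[of u v w]
          card_beyond_le_4[OF n(3)]]) (use u in auto)
  have "colorable 7 E (insert {u, w} (insert {u, v} ?F))"
    by (rule colorable_insert[OF c1 n(2) card_beyond_le_2[of u w v] card_beyond_le_4[OF n(4)]])
      (use u in auto)
  moreover have "insert {u, w} (insert {u, v} ?F) = E"
    using nbrs_mem n u induced_subset by (intro edges_cover[of "{u}"]) auto
  ultimately show ?thesis by simp
qed

text \<open>The outer edges have at most 1 + 4 conflicts each; the middle edge, coloured last, has 2
  + 2.\<close>

lemma reduce_adjacent_two_vertices:
  assumes col: "colorable 6 (induced E (V - {u, v})) (induced E (V - {u, v}))"
    and u: "nbrs E u = {a, v}" "a \<noteq> v" and v: "nbrs E v = {u, b}" "u \<noteq> b"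
  shows "colorable 6 E E"
proof -
  let ?F = "induced E (V - {u, v})"
  have n: "a \<in> nbrs E u" "v \<in> nbrs E u" "b \<in> nbrs E v" "u \<in> nbrs E a" "u \<in> nbrs E v" "v \<in> nbrs E b"
    using u v nbrs_sym[of a E u] nbrs_sym[of b E v] by auto
  have b1: "card (beyond E u a \<inter> F) \<le> 1" for F
  proof -
    have "beyond E u a \<inter> F \<subseteq> {{v, b}}" using u v by (auto simp: beyond_def)
    then show ?thesis using card_mono[of "{{v, b}}"] by auto
  qed
  have b2: "card (beyond E v b \<inter> F) \<le> 1" for F
  proof -
    have "beyond E v b \<inter> F \<subseteq> {{u, a}}" using u v by (auto simp: beyond_def)
    then show ?thesis using card_mono[of "{{u, a}}"] by auto
  qed
  have c1: "colorable 6 E (insert {u, a} ?F)"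
    by (rule colorable_insert[OF colorable_induced[OF col] n(1) b1 card_beyond_le_4[OF n(4)]]) simp
  have c2: "colorable 6 E (insert {v, b} (insert {u, a} ?F))"
    by (rule colorable_insert[OF c1 n(3) b2 card_beyond_le_4[OF n(6)]]) simp
  have "colorable 6 E (insert {u, v} (insert {v, b} (insert {u, a} ?F)))"
    by (rule colorable_insert[OF c2 n(2) card_beyond_le_2[of u v a] card_beyond_le_2[of v u b]])
      (use u v in auto)
  moreover have "insert {u, v} (insert {v, b} (insert {u, a} ?F)) = E"
    using nbrs_mem[OF n(1)] nbrs_mem[OF n(2)] nbrs_mem[OF n(3)] induced_subset
    by (intro edges_cover[of "{u, v}"]) (auto simp: u(1) v(1) doubleton_eq_iff)
  ultimately show ?thesis by simp
qed

text \<open>The order \<open>{u, a}\<close>, \<open>{v, x}\<close>, \<open>{w, b}\<close>,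
  \<open>{u, v}\<close>, \<open>{w, v}\<close> keeps the coloured conflicts at 0 + 4, 1 + 4, 1 + 4,
  2 + 3, 2 + 3: the edges from \<open>v\<close> to its 2-neighbours come last, because while
  uncoloured they do not burden the others.\<close>

lemma reduce_two_two_neighbours:
  assumes col: "colorable 6 (induced E (V - {u, v, w})) (induced E (V - {u, v, w}))"
    and v: "nbrs E v = {u, w, x}" "u \<noteq> w" "u \<noteq> x" "w \<noteq> x"
    and u: "nbrs E u = {v, a}" "v \<noteq> a" and w: "nbrs E w = {v, b}" "v \<noteq> b"
  shows "colorable 6 E E"
proof -
  let ?F = "induced E (V - {u, v, w})"
  have n: "a \<in> nbrs E u" "b \<in> nbrs E w" "u \<in> nbrs E v" "w \<in> nbrs E v" "x \<in> nbrs E v"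
    "u \<in> nbrs E a" "w \<in> nbrs E b" "v \<in> nbrs E x" "v \<noteq> u" "v \<noteq> w"
    "v \<in> nbrs E u" "v \<in> nbrs E w"
    using u v w nbrs_sym[of a E u] nbrs_sym[of b E w] nbrs_sym[of x E v] nbrs_irrefl[of v] by auto
  note ni = not_in_induced[of u "{u, v, w}"] not_in_induced[of v "{u, v, w}"] not_in_induced[of w "{u, v, w}"]
  have "beyond E u a \<inter> ?F = {}" using u v ni by (auto simp: beyond_def)
  then have b1: "card (beyond E u a \<inter> ?F) \<le> 0" by simp
  have c1: "colorable 6 E (insert {u, a} ?F)"
    by (rule colorable_insert[OF colorable_induced[OF col] n(1) b1 card_beyond_le_4[OF n(6)]]) simp
  have "beyond E v x \<inter> insert {u, a} ?F \<subseteq> {{u, a}}" using u v w ni by (auto simp: beyond_def)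
  then have b2: "card (beyond E v x \<inter> insert {u, a} ?F) \<le> 1"
    using card_mono[of "{{u, a}}"] by auto
  have c2: "colorable 6 E (insert {v, x} (insert {u, a} ?F))"
    by (rule colorable_insert[OF c1 n(5) b2 card_beyond_le_4[OF n(8)]]) simp
  have "beyond E w b \<inter> insert {v, x} (insert {u, a} ?F) \<subseteq> {{v, x}}"
    using u v w n ni by (auto simp: beyond_def doubleton_eq_iff)
  then have b3: "card (beyond E w b \<inter> insert {v, x} (insert {u, a} ?F)) \<le> 1"
    using card_mono[of "{{v, x}}"] by auto
  have c3: "colorable 6 E (insert {w, b} (insert {v, x} (insert {u, a} ?F)))"
    by (rule colorable_insert[OF c2 n(2) b3 card_beyond_le_4[OF n(7)]]) simp
  have bv: "card (beyond E v s \<inter> F) \<le> 3" if "s = u \<and> t = w \<or> s = w \<and> t = u" for s t F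
  proof -
    have t: "nbrs E v - {s} = {t, x}" "card (nbrs E t) = 2" "t \<noteq> x" using that u v w by auto
    have "card (beyond E v s \<inter> F) \<le> card (beyond E v s)"
      using finite_E beyond_subset by (intro card_mono) (auto intro: finite_subset)
    also have "\<dots> \<le> (card (nbrs E t) - 1) + (card (nbrs E x) - 1)" using card_beyond[of v s] t by simp
    finally show ?thesis using t card_nbrs_le[of x] by simp
  qed
  have c4: "colorable 6 E (insert {u, v} (insert {w, b} (insert {v, x} (insert {u, a} ?F))))"
    by (rule colorable_insert[OF c3 _ card_beyond_le_2[of u v a] bv[of u w]]) (use u in auto)
  have "colorable 6 E (insert {w, v} (insert {u, v} (insert {w, b} (insert {v, x} (insert {u, a} ?F)))))"
    by (rule colorable_insert[OF c4 _ card_beyond_le_2[of w v b] bv[of w u]]) (use w in auto)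
  moreover have "insert {w, v} (insert {u, v} (insert {w, b} (insert {v, x} (insert {u, a} ?F)))) = E"
    using nbrs_mem[OF n(1)] nbrs_mem[OF n(2)] nbrs_mem[OF n(5)] nbrs_mem[OF n(11)] nbrs_mem[OF n(12)]
      induced_subset
    by (intro edges_cover[of "{u, v, w}"]) (auto simp: u(1) v(1) w(1) doubleton_eq_iff)
  ultimately show ?thesis by simp
qed

text \<open>In the order \<open>{p, a}\<close>, \<open>{q, v}\<close>, \<open>{p, q}\<close> the
  coloured conflicts are at most 0 + 4, 1 + 3, 2 + 2. The condition on \<open>v\<close> covers both
  a 2-vertex and a 3-vertex with a further 2-neighbour.\<close>

lemma reduce_two_two_edge:
  assumes col: "colorable 5 (induced E (V - {p, q})) (induced E (V - {p, q}))"
    and p: "nbrs E p = {a, q}" "a \<noteq> q" and q: "nbrs E q = {p, v}" "p \<noteq> v"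
    and v: "(\<Sum>y\<in>nbrs E v - {q}. card (nbrs E y) - 1) \<le> 3"
  shows "colorable 5 E E"
proof -
  let ?F = "induced E (V - {p, q})"
  have n: "a \<in> nbrs E p" "q \<in> nbrs E p" "v \<in> nbrs E q" "p \<in> nbrs E a" "q \<in> nbrs E v"
    using p q nbrs_sym[of a E p] nbrs_sym[of v E q] by auto
  note ni = not_in_induced[of p "{p, q}"] not_in_induced[of q "{p, q}"]
  have "beyond E p a \<inter> ?F = {}" using p q ni by (auto simp: beyond_def)
  then have b1: "card (beyond E p a \<inter> ?F) \<le> 0" by simp
  have c1: "colorable 5 E (insert {p, a} ?F)"
    by (rule colorable_insert[OF colorable_induced[OF col] n(1) b1 card_beyond_le_4[OF n(4)]]) simp
  have "beyond E q v \<inter> insert {p, a} ?F \<subseteq> {{p, a}}" using p q by (auto simp: beyond_def)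
  then have b2: "card (beyond E q v \<inter> insert {p, a} ?F) \<le> 1"
    using card_mono[of "{{p, a}}"] by auto
  have "card (beyond E v q \<inter> insert {p, a} ?F) \<le> card (beyond E v q)"
    using finite_E beyond_subset by (intro card_mono) (auto intro: finite_subset)
  then have b3: "card (beyond E v q \<inter> insert {p, a} ?F) \<le> 3" using card_beyond[of v q] v by simp
  have c2: "colorable 5 E (insert {q, v} (insert {p, a} ?F))"
    by (rule colorable_insert[OF c1 n(3) b2 b3]) simp
  have "colorable 5 E (insert {p, q} (insert {q, v} (insert {p, a} ?F)))"
    by (rule colorable_insert[OF c2 n(2) card_beyond_le_2[of p q a] card_beyond_le_2[of q p v]])
      (use p q in auto)
  moreover have "insert {p, q} (insert {q, v} (insert {p, a} ?F)) = E"
    using nbrs_mem[OF n(1)] nbrs_mem[OF n(2)] nbrs_mem[OF n(3)] induced_subset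
    by (intro edges_cover[of "{p, q}"]) (auto simp: p(1) q(1) doubleton_eq_iff)
  ultimately show ?thesis by simp
qed

text \<open>As long as the edges at \<open>v\<close> are uncoloured, each outer edge has at most 0 +
  4 conflicts; then each edge at \<open>v\<close> has 2 + 2.\<close>

lemma reduce_three_two_neighbours:
  fixes u1 u2 u3 v
  defines "D \<equiv> {v, u1, u2, u3}"
  assumes col: "colorable 5 (induced E (V - D)) (induced E (V - D))"
    and v: "nbrs E v = {u1, u2, u3}" "distinct [u1, u2, u3]"
    and u1: "nbrs E u1 = {v, a1}" "v \<noteq> a1" and u2: "nbrs E u2 = {v, a2}" "v \<noteq> a2"
    and u3: "nbrs E u3 = {v, a3}" "v \<noteq> a3"
  shows "colorable 5 E E"
proof -
  let ?F0 = "induced E (V - D)"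
  let ?F1 = "insert {u1, a1} ?F0"
  let ?F2 = "insert {u2, a2} ?F1"
  let ?F3 = "insert {u3, a3} ?F2"
  have n: "a1 \<in> nbrs E u1" "a2 \<in> nbrs E u2" "a3 \<in> nbrs E u3" "u1 \<in> nbrs E a1" "u2 \<in> nbrs E a2"
    "u3 \<in> nbrs E a3" "v \<in> nbrs E u1" "v \<in> nbrs E u2" "v \<in> nbrs E u3"
    using u1 u2 u3 nbrs_sym[of a1 E u1] nbrs_sym[of a2 E u2] nbrs_sym[of a3 E u3] by auto
  have vu: "v \<noteq> u1" "v \<noteq> u2" "v \<noteq> u3" using v nbrs_irrefl[of v] by auto
  have ni: "{v, y} \<notin> ?F0" "{y, v} \<notin> ?F0" for y using not_in_induced[of v D] by (auto simp: D_def)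
  have nv: "{v, y} \<notin> ?F3" "{y, v} \<notin> ?F3" for y
    using ni[of y] vu u1(2) u2(2) u3(2) by (auto simp: doubleton_eq_iff)
  have bu: "card (beyond E u a \<inter> F) \<le> 0" if "nbrs E u = {v, a}" "F \<subseteq> ?F3" for u a F
  proof -
    have "beyond E u a \<inter> F = {}" using that nv by (auto simp: beyond_def)
    then show ?thesis by simp
  qed
  have c1: "colorable 5 E ?F1"
    by (rule colorable_insert[OF colorable_induced[OF col] n(1) bu[OF u1(1)] card_beyond_le_4[OF n(4)]])
      auto
  have c2: "colorable 5 E ?F2"
    by (rule colorable_insert[OF c1 n(2) bu[OF u2(1)] card_beyond_le_4[OF n(5)]]) auto
  have c3: "colorable 5 E ?F3"
    by (rule colorable_insert[OF c2 n(3) bu[OF u3(1)] card_beyond_le_4[OF n(6)]]) auto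
  have bv: "card (beyond E v u \<inter> F) \<le> 2" if u: "u \<in> {u1, u2, u3}" for u F
  proof -
    have "card (nbrs E y) = 2" if "y \<in> nbrs E v" for y using that v u1 u2 u3 by auto
    then have "(\<Sum>y\<in>nbrs E v - {u}. card (nbrs E y) - 1) = card (nbrs E v - {u})" by simp
    moreover have "card (nbrs E v - {u}) = 2" using v u by auto
    ultimately have "card (beyond E v u) \<le> 2" using card_beyond[of v u] by simp
    moreover have "card (beyond E v u \<inter> F) \<le> card (beyond E v u)"
      using finite_E beyond_subset by (intro card_mono) (auto intro: finite_subset)
    ultimately show ?thesis by simp
  qed
  have c4: "colorable 5 E (insert {u1, v} ?F3)"
    by (rule colorable_insert[OF c3 n(7) card_beyond_le_2[of u1 v a1] bv]) (use u1 in auto)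
  have c5: "colorable 5 E (insert {u2, v} (insert {u1, v} ?F3))"
    by (rule colorable_insert[OF c4 n(8) card_beyond_le_2[of u2 v a2] bv]) (use u2 in auto)
  have "colorable 5 E (insert {u3, v} (insert {u2, v} (insert {u1, v} ?F3)))"
    by (rule colorable_insert[OF c5 n(9) card_beyond_le_2[of u3 v a3] bv]) (use u3 in auto)
  moreover have "insert {u3, v} (insert {u2, v} (insert {u1, v} ?F3)) = E"
  proof (rule edges_cover[of D])
    show "insert {u3, v} (insert {u2, v} (insert {u1, v} ?F3)) \<subseteq> E"
      using nbrs_mem[OF n(1)] nbrs_mem[OF n(2)] nbrs_mem[OF n(3)] nbrs_mem[OF n(7)] nbrs_mem[OF n(8)]
        nbrs_mem[OF n(9)] induced_subset by simp
    show "\<forall>y\<in>nbrs E d. {d, y} \<in> insert {u3, v} (insert {u2, v} (insert {u1, v} ?F3))"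
      if "d \<in> D" for d
    proof -
      have "{v, u1} = {u1, v}" "{v, u2} = {u2, v}" "{v, u3} = {u3, v}" by auto
      moreover have "d = v \<or> d = u1 \<or> d = u2 \<or> d = u3" using that by (simp add: D_def)
      ultimately show ?thesis by (elim disjE) (simp_all add: v(1) u1(1) u2(1) u3(1))
    qed
  qed blast
  ultimately show ?thesis by simp
qed

end

section \<open>Reductions for four colours\<close>

text \<open>Here \<^term>\<open>h v\<close> is the colour of a virtual pendant edge at \<^term>\<open>v\<close>, present at every vertex of
  degree at most 2. When a set of vertices is deleted, it reserves a colour for the edges that are cut.\<close>

definition seen_colors :: "'a set set \<Rightarrow> ('a set \<Rightarrow> nat) \<Rightarrow> ('a \<Rightarrow> nat) \<Rightarrow> 'a \<Rightarrow> 'a \<Rightarrow> nat set" where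
  "seen_colors E c h v w =
     (\<lambda>x. c {v, x}) ` (nbrs E v - {w}) \<union> (if card (nbrs E v) \<le> 2 then {h v} else {})"

text \<open>An injective colouring of the graph with all virtual pendant edges added, except that no
  edge is checked as the middle one unless it is real.\<close>

definition full_coloring :: "'a set \<Rightarrow> 'a set set \<Rightarrow> ('a set \<Rightarrow> nat) \<Rightarrow> ('a \<Rightarrow> nat) \<Rightarrow> bool" where
  "full_coloring V E c h \<longleftrightarrow> c \<in> E \<rightarrow> {1..4} \<and> h \<in> V \<rightarrow> {1..4} \<and>
     (\<forall>v w. w \<in> nbrs E v \<longrightarrow> seen_colors E c h v w \<inter> seen_colors E c h w v = {})"

text \<open>A cut edge takes the virtual colour of its end outside \<open>D\<close>, which is the
  only element of \<open>e - D\<close>.\<close>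

definition extend_edges :: "('a set \<Rightarrow> nat) \<Rightarrow> ('a \<Rightarrow> nat) \<Rightarrow> 'a set \<Rightarrow> ('a set \<Rightarrow> nat) \<Rightarrow> 'a set \<Rightarrow> nat" where
  "extend_edges c h D i e = (if e \<inter> D = {} then c e else if e \<subseteq> D then i e else h (the_elem (e - D)))"

definition extend_vertices :: "('a \<Rightarrow> nat) \<Rightarrow> 'a set \<Rightarrow> ('a \<Rightarrow> nat) \<Rightarrow> 'a \<Rightarrow> nat" where
  "extend_vertices h D k v = (if v \<in> D then k v else h v)"

text \<open>The value of \<open>seen_colors\<close> at a vertex outside \<open>D\<close> after the
  extension. It does not involve the new colours, so these can be chosen against it.\<close>

definition outer_colors :: "'a set set \<Rightarrow> ('a set \<Rightarrow> nat) \<Rightarrow> ('a \<Rightarrow> nat) \<Rightarrow> 'a set \<Rightarrow> 'a \<Rightarrow> 'a \<Rightarrow> nat set" where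
  "outer_colors E c h D a d =
     (\<lambda>x. if x \<in> D then h a else c {a, x}) ` (nbrs E a - {d}) \<union> (if card (nbrs E a) \<le> 2 then {h a} else {})"

lemma colorable_if_full_coloring:
  assumes "full_coloring V E c h" shows "colorable 4 E E"
proof -
  have "c e \<noteq> c f" if "conflict E e f" for e f
    using that
  proof (rule conflictE)
    fix a b c' d
    assume *: "e = {a, b}" "f = {c', d}" "{a, b} \<in> E" "{b, c'} \<in> E" "{c', d} \<in> E" "a \<noteq> c'" "b \<noteq> d"
    then have "a \<in> nbrs E b - {c'}" "d \<in> nbrs E c' - {b}" "c' \<in> nbrs E b"
      by (auto simp: nbrs_def insert_commute)
    then have "c {b, a} \<in> seen_colors E c h b c'" "c {c', d} \<in> seen_colors E c h c' b"
      "seen_colors E c h b c' \<inter> seen_colors E c h c' b = {}"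
      using assms by (auto simp: seen_colors_def full_coloring_def)
    moreover have "e = {b, a}" using * by auto
    ultimately show ?thesis using *(2) by auto
  qed
  then show ?thesis using assms unfolding colorable_def full_coloring_def by blast
qed

lemma color_avoiding:
  assumes "finite X" "card X \<le> 3" obtains j :: nat where "j \<in> {1..4}" "j \<notin> X"
proof -
  have "\<not> {1..4} \<subseteq> X" using assms card_mono[of X "{1..4}"] by auto
  then show ?thesis using that by blast
qed

lemma two_colors_avoiding:
  assumes "finite X" "card X \<le> 2"
  obtains i j :: nat where "i \<in> {1..4}" "j \<in> {1..4}" "i \<notin> X" "j \<notin> X" "i \<noteq> j"
proof -
  obtain i where i: "i \<in> {1..4}" "i \<notin> X" using color_avoiding[of X] assms by auto
  obtain j where "j \<in> {1..4}" "j \<notin> insert i X"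
    using color_avoiding[of "insert i X"] assms i by auto
  then show ?thesis using that i by auto
qed

text \<open>The conflicts form a path \<^term>\<open>s1\<close>, \<^term>\<open>p3\<close>, \<^term>\<open>p2\<close>, \<^term>\<open>p1\<close>,
  \<^term>\<open>s2\<close>, whose lists may have only 1, 2, 2, 2, 1 colours. Arbitrary lists of these sizes would
  not do, but those of \<^term>\<open>s1\<close> and \<^term>\<open>p1\<close> both come from \<^term>\<open>A\<close>, and those of
  \<^term>\<open>s2\<close> and \<^term>\<open>p3\<close> from \<^term>\<open>B\<close>.\<close>

lemma three_two_vertices_colors:
  fixes \<alpha> \<beta> :: nat
  assumes A: "finite A" "card A \<le> 2" and B: "finite B" "card B \<le> 2"
  obtains s1 s2 p1 p2 p3 where "{s1, s2, p1, p2, p3} \<subseteq> {1..4}" "s1 \<notin> A" "p1 \<notin> A" "s2 \<notin> B" "p3 \<notin> B"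
    "s1 \<noteq> \<beta>" "s2 \<noteq> \<alpha>" "p1 \<noteq> s2" "p3 \<noteq> s1" "p2 \<notin> {\<alpha>, \<beta>, p1, p3}"
proof -
  obtain x y where xy: "x \<in> {1..4}" "y \<in> {1..4}" "x \<notin> A" "y \<notin> A" "x \<noteq> y"
    using two_colors_avoiding[OF A] .
  obtain z w where zw: "z \<in> {1..4}" "w \<in> {1..4}" "z \<notin> B" "w \<notin> B" "z \<noteq> w"
    using two_colors_avoiding[OF B] .
  have other: "\<exists>t\<in>{x, y}. t \<noteq> u" "\<exists>t\<in>{z, w}. t \<noteq> u" for u using xy zw by auto
  have avoid: "\<exists>p\<in>{1..4}. p \<notin> {a, b, c}" for a b c :: nat
  proof -
    have "card {a, b, c} \<le> 3" by (simp add: card_insert_if)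
    then obtain j where "j \<in> {1..4}" "j \<notin> {a, b, c}" using color_avoiding[of "{a, b, c}"] by auto
    then show ?thesis by blast
  qed
  note result = that
  have res: thesis if "s1 \<in> {x, y}" "p1 \<in> {x, y}" "s2 \<in> {z, w}" "p3 \<in> {z, w}" "p2 \<in> {1..4}"
    "s1 \<noteq> \<beta>" "s2 \<noteq> \<alpha>" "p1 \<noteq> s2" "p3 \<noteq> s1" "p2 \<notin> {\<alpha>, \<beta>, p1, p3}" for s1 s2 p1 p2 p3
  proof (rule result[of s1 s2 p1 p2 p3])
    show "{s1, s2, p1, p2, p3} \<subseteq> {1..4}" "s1 \<notin> A" "p1 \<notin> A" "s2 \<notin> B" "p3 \<notin> B"
      using that(1-5) xy zw by auto
  qed fact+
  consider "\<beta> \<notin> {x, y}" | "\<alpha> \<notin> {z, w}" | "\<beta> \<in> {x, y}" "\<alpha> \<in> {z, w}" by blast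
  then show thesis
  proof cases
    \<comment> \<open>Here \<open>s1\<close> keeps two choices, so the path is coloured greedily
      from its other end \<open>s2\<close>. The next case is the mirror image.\<close>
    case 1
    obtain s2 where s2: "s2 \<in> {z, w}" "s2 \<noteq> \<alpha>" using other by blast
    obtain p1 where p1: "p1 \<in> {x, y}" "p1 \<noteq> s2" using other by blast
    obtain p2 where p2: "p2 \<in> {1..4}" "p2 \<notin> {\<alpha>, \<beta>, p1}" using avoid by blast
    obtain p3 where p3: "p3 \<in> {z, w}" "p3 \<noteq> p2" using other by blast
    obtain s1 where s1: "s1 \<in> {x, y}" "s1 \<noteq> p3" using other by blast
    show thesis using 1 s1 s2 p1 p2 p3 by (intro res[of s1 p1 s2 p3 p2]) auto
  next
    case 2
    obtain s1 where s1: "s1 \<in> {x, y}" "s1 \<noteq> \<beta>" using other by blast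
    obtain p3 where p3: "p3 \<in> {z, w}" "p3 \<noteq> s1" using other by blast
    obtain p2 where p2: "p2 \<in> {1..4}" "p2 \<notin> {\<alpha>, \<beta>, p3}" using avoid by blast
    obtain p1 where p1: "p1 \<in> {x, y}" "p1 \<noteq> p2" using other by blast
    obtain s2 where s2: "s2 \<in> {z, w}" "s2 \<noteq> p1" using other by blast
    show thesis using 2 s1 s2 p1 p2 p3 by (intro res[of s1 p1 s2 p3 p2]) auto
  next
    \<comment> \<open>Now \<open>s1 = m\<close> and \<open>s2 = n\<close> are forced. In each
      subcase \<open>p1\<close> and \<open>p3\<close> are chosen so that \<open>\<alpha>\<close>,
      \<open>\<beta>\<close>, \<open>p1\<close>, \<open>p3\<close> take at most three values, which
      leaves a colour for \<open>p2\<close>.\<close>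
    case 3
    obtain m where m: "m \<in> {x, y}" "m \<noteq> \<beta>" using other by blast
    obtain n where n: "n \<in> {z, w}" "n \<noteq> \<alpha>" using other by blast
    consider "m = n" | "m \<noteq> n" "n \<noteq> \<beta>" | "m \<noteq> n" "n = \<beta>" by blast
    then show thesis
    proof cases
      case 1
      obtain p2 where "p2 \<in> {1..4}" "p2 \<notin> {\<alpha>, \<beta>, \<beta>}" using avoid by blast
      then show thesis using 1 3 m n by (intro res[of m \<beta> n \<alpha> p2]) auto
    next
      case 2
      obtain p2 where "p2 \<in> {1..4}" "p2 \<notin> {\<alpha>, \<beta>, n}" using avoid by blast
      then show thesis using 2 3 m n by (intro res[of m \<beta> n n p2]) auto
    next
      case nb: 3
      obtain p2 where "p2 \<in> {1..4}" "p2 \<notin> {\<alpha>, \<beta>, m}" using avoid by blast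
      then show thesis using nb 3 m n by (intro res[of m m n n p2]) auto
    qed
  qed
qed

section \<open>Extending a full coloring over deleted vertices\<close>

context subcubic_graph
begin

lemma extend_edges_outer:
  assumes "a \<notin> D" "d \<in> D"
  shows "extend_edges c h D i {a, d} = h a" "extend_edges c h D i {d, a} = h a"
proof -
  have "{a, d} - D = {a}" using assms by auto
  then show "extend_edges c h D i {a, d} = h a" using assms by (simp add: extend_edges_def)
  then show "extend_edges c h D i {d, a} = h a" by (simp add: insert_commute)
qed

lemma extend_edges_inner: "\<lbrakk>d \<in> D; d' \<in> D\<rbrakk> \<Longrightarrow> extend_edges c h D i {d, d'} = i {d, d'}"
  by (simp add: extend_edges_def)

lemma seen_colors_outer:
  assumes "a \<notin> D"
  shows "seen_colors E (extend_edges c h D i) (extend_vertices h D k) a d = outer_colors E c h D a d"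
proof -
  have "extend_edges c h D i {a, x} = (if x \<in> D then h a else c {a, x})" for x
    using assms extend_edges_outer(1)[of a D x] by (simp add: extend_edges_def)
  then show ?thesis using assms by (simp add: seen_colors_def outer_colors_def extend_vertices_def)
qed

text \<open>A vertex of degree 3 shows two edges across \<open>{a, d}\<close>; one of lower degree
  shows at most one edge and its virtual one.\<close>

lemma outer_colors_card:
  assumes "d \<in> nbrs E a"
  shows "finite (outer_colors E c h D a d)" "card (outer_colors E c h D a d) \<le> 2"
proof -
  let ?I = "(\<lambda>x. if x \<in> D then h a else c {a, x}) ` (nbrs E a - {d})"
  show "finite (outer_colors E c h D a d)" by (simp add: outer_colors_def)
  have I: "card ?I \<le> card (nbrs E a) - 1"
    using assms by (intro order.trans[OF card_image_le]) auto
  have "1 \<le> card (nbrs E a)" using assms by (auto simp: Suc_le_eq card_gt_0_iff)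
  then show "card (outer_colors E c h D a d) \<le> 2"
    using I card_nbrs_le[of a] card_Un_le[of ?I "{h a}"] by (auto simp: outer_colors_def)
qed

text \<open>Only edges that meet \<open>D\<close> have to be checked. A vertex outside
  \<open>D\<close> that loses a neighbour has degree at most 2 in the rest, so its virtual colour
  was seen there already, and using it for the cut edges shows nothing new.\<close>

lemma full_coloring_extend:
  assumes D: "D \<subseteq> V" and full: "full_coloring (V - D) (induced E (V - D)) c h"
    and inner: "\<And>e. \<lbrakk>e \<in> E; e \<subseteq> D\<rbrakk> \<Longrightarrow> i e \<in> {1..4}" and k: "\<And>d. d \<in> D \<Longrightarrow> k d \<in> {1..4}"
    and new: "\<And>d y. \<lbrakk>d \<in> D; y \<in> nbrs E d\<rbrakk> \<Longrightarrow>
        seen_colors E (extend_edges c h D i) (extend_vertices h D k) d y \<inter>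
        (if y \<in> D then seen_colors E (extend_edges c h D i) (extend_vertices h D k) y d
         else outer_colors E c h D y d) = {}"
  shows "full_coloring V E (extend_edges c h D i) (extend_vertices h D k)"
proof -
  let ?c = "extend_edges c h D i" and ?h = "extend_vertices h D k"
  have "?c e \<in> {1..4}" if e: "e \<in> E" for e
  proof -
    obtain u v where uv: "e = {u, v}" using edgeE[OF e] .
    then have V: "u \<in> V" "v \<in> V" using edge_in e by auto
    show ?thesis
    proof (cases "u \<in> D"; cases "v \<in> D")
      assume "u \<in> D" "v \<in> D"
      then show ?thesis using inner[OF e] extend_edges_inner[of u D v c h i] uv by auto
    next
      assume "u \<in> D" "v \<notin> D"
      then show ?thesis using extend_edges_outer[of v D u] uv V full by (auto simp: full_coloring_def)
    next
      assume "u \<notin> D" "v \<in> D"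
      then show ?thesis using extend_edges_outer[of u D v] uv V full by (auto simp: full_coloring_def)
    next
      assume "u \<notin> D" "v \<notin> D"
      then have "e \<in> induced E (V - D)" "e \<inter> D = {}" using e uv V by (auto simp: induced_def)
      then show ?thesis using full unfolding full_coloring_def extend_edges_def by auto
    qed
  qed
  moreover have "?h \<in> V \<rightarrow> {1..4}"
    using full k by (auto simp: full_coloring_def extend_vertices_def)
  moreover have "seen_colors E ?c ?h v w \<inter> seen_colors E ?c ?h w v = {}" if w: "w \<in> nbrs E v" for v w
  proof -
    have v: "v \<in> nbrs E w" using w nbrs_sym by metis
    consider "v \<in> D" | "w \<in> D" | "v \<notin> D" "w \<notin> D" by blast
    then show ?thesis
    proof cases
      case 1
      then show ?thesis using new[OF 1 w] seen_colors_outer[of w D] by (auto split: if_splits)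
    next
      case 2
      then show ?thesis using new[OF 2 v] seen_colors_outer[of v D] by (auto split: if_splits)
    next
      case 3
      have sub: "seen_colors E ?c ?h a b \<subseteq> seen_colors (induced E (V - D)) c h a b"
        if a: "a \<in> V" "a \<notin> D" for a b
      proof -
        have n: "nbrs (induced E (V - D)) a = nbrs E a - D"
          using a edge_in by (auto simp: nbrs_def induced_def)
        have "card (nbrs (induced E (V - D)) a) \<le> card (nbrs E a)" unfolding n by (intro card_mono) auto
        moreover have "card (nbrs (induced E (V - D)) a) \<le> 2" if "x \<in> nbrs E a" "x \<in> D" for x
        proof -
          have "card (nbrs E a - D) < card (nbrs E a)" using that by (intro psubset_card_mono) auto
          then show ?thesis using card_nbrs_le[of a] n by simp
        qed
        ultimately show ?thesis
          unfolding seen_colors_outer[OF a(2)] unfolding outer_colors_def seen_colors_def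
          using n by auto
      qed
      have "v \<in> V" "w \<in> V" using w edge_in[of v w] by (auto simp: nbrs_def)
      moreover have "w \<in> nbrs (induced E (V - D)) v"
        using w 3 \<open>v \<in> V\<close> \<open>w \<in> V\<close> by (auto simp: nbrs_def induced_def)
      ultimately show ?thesis
        using full sub[of v w] sub[of w v] 3 unfolding full_coloring_def by blast
    qed
  qed
  ultimately show ?thesis unfolding full_coloring_def by blast
qed

text \<open>The edge at \<open>u\<close>, if any, takes the virtual colour of its other end; what
  remains is the virtual colour \<open>j\<close> of \<open>u\<close>, which has at most two colours
  to avoid.\<close>

lemma full_reduce_low_degree:
  assumes uV: "u \<in> V" and full: "full_coloring (V - {u}) (induced E (V - {u})) c h"
    and u: "card (nbrs E u) \<le> 1"
  shows "\<exists>c h. full_coloring V E c h"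
proof -
  have "\<exists>j\<in>{1..4}. \<forall>v\<in>nbrs E u. j \<notin> outer_colors E c h {u} v u"
  proof -
    consider "nbrs E u = {}" | v where "nbrs E u = {v}"
      using u by (metis One_nat_def card_1_singletonE card_eq_0_iff finite_nbrs le_Suc_eq le_zero_eq)
    then show ?thesis
    proof cases
      case (2 v)
      then have "u \<in> nbrs E v" using nbrs_sym[of v E u] by auto
      then obtain j where "j \<in> {1..4}" "j \<notin> outer_colors E c h {u} v u"
        using color_avoiding[of "outer_colors E c h {u} v u"] outer_colors_card[of u v c h "{u}"] by auto
      then show ?thesis unfolding 2 by blast
    qed auto
  qed
  then obtain j where j: "j \<in> {1..4}" "\<And>v. v \<in> nbrs E u \<Longrightarrow> j \<notin> outer_colors E c h {u} v u" by blast
  \<comment> \<open>\<open>\<lambda>_. 1\<close> is a dummy, as no edge lies within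
    \<open>{u}\<close>.\<close>
  have "full_coloring V E (extend_edges c h {u} (\<lambda>_. 1)) (extend_vertices h {u} (\<lambda>_. j))"
  proof (rule full_coloring_extend[OF _ full])
    fix d y assume dy: "d \<in> {u}" "y \<in> nbrs E d"
    then have e: "nbrs E u - {y} = {}" using u by (auto simp: card_le_Suc0_iff_eq)
    have "seen_colors E (extend_edges c h {u} (\<lambda>_. 1)) (extend_vertices h {u} (\<lambda>_. j)) u y \<subseteq> {j}"
      unfolding seen_colors_def extend_vertices_def e by simp
    moreover have "y \<notin> {u}" using dy nbrs_irrefl by auto
    ultimately show "seen_colors E (extend_edges c h {u} (\<lambda>_. 1)) (extend_vertices h {u} (\<lambda>_. j)) d y \<inter>
        (if y \<in> {u} then seen_colors E (extend_edges c h {u} (\<lambda>_. 1)) (extend_vertices h {u} (\<lambda>_. j)) y d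
         else outer_colors E c h {u} y d) = {}"
      using j(2) dy by auto
  qed (use uV j in auto)
  then show ?thesis by blast
qed

text \<open>The outer edges take \<open>h a\<close> and \<open>h b\<close>. To be found are
  \<open>s1\<close>, \<open>s2\<close> for the inner edges and \<open>p1\<close>, \<open>p2\<close>,
  \<open>p3\<close> for the virtual ones; the four edges of the thread impose exactly the conditions
  of \<open>three_two_vertices_colors\<close>.\<close>

lemma full_reduce_three_two_vertices:
  fixes v1 v2 v3 a b
  defines "D \<equiv> {v1, v2, v3}"
  assumes D: "D \<subseteq> V" and full: "full_coloring (V - D) (induced E (V - D)) c h"
    and v1: "nbrs E v1 = {a, v2}" and v2: "nbrs E v2 = {v1, v3}" and v3: "nbrs E v3 = {v2, b}"
    and ab: "a \<notin> D" "b \<notin> D" and v13: "v1 \<noteq> v3"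
  shows "\<exists>c h. full_coloring V E c h"
proof -
  have n: "v1 \<in> nbrs E a" "v3 \<in> nbrs E b" using v1 v3 nbrs_sym[of a E v1] nbrs_sym[of b E v3] by auto
  have ne: "v1 \<noteq> v2" "v2 \<noteq> v3" using v2 nbrs_irrefl[of v2] by auto
  obtain s1 s2 p1 p2 p3 where s: "{s1, s2, p1, p2, p3} \<subseteq> {1..4}"
    "s1 \<notin> outer_colors E c h D a v1" "p1 \<notin> outer_colors E c h D a v1"
    "s2 \<notin> outer_colors E c h D b v3" "p3 \<notin> outer_colors E c h D b v3"
    "s1 \<noteq> h b" "s2 \<noteq> h a" "p1 \<noteq> s2" "p3 \<noteq> s1" "p2 \<notin> {h a, h b, p1, p3}"
    using three_two_vertices_colors[OF outer_colors_card[OF n(1)] outer_colors_card[OF n(2)]] .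
  define i where "i = (\<lambda>e. if v1 \<in> e then s1 else s2)"
  define k where "k = (\<lambda>d. if d = v1 then p1 else if d = v2 then p2 else p3)"
  let ?c = "extend_edges c h D i" and ?h = "extend_vertices h D k"
  have mem: "v1 \<in> D" "v2 \<in> D" "v3 \<in> D" by (auto simp: D_def)
  have c: "?c {v1, a} = h a" "?c {v1, v2} = s1" "?c {v2, v1} = s1" "?c {v2, v3} = s2" "?c {v3, v2} = s2"
    "?c {v3, b} = h b"
    using ab ne v13 mem by (simp_all add: extend_edges_outer extend_edges_inner i_def)
  have h: "?h v1 = p1" "?h v2 = p2" "?h v3 = p3"
    using ne v13 mem by (auto simp: extend_vertices_def k_def)
  have ne': "a \<noteq> v2" "b \<noteq> v2" using ab mem by auto
  have sets: "nbrs E v1 - {a} = {v2}" "nbrs E v1 - {v2} = {a}" "nbrs E v2 - {v1} = {v3}"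
    "nbrs E v2 - {v3} = {v1}" "nbrs E v3 - {v2} = {b}" "nbrs E v3 - {b} = {v2}"
    "card (nbrs E v1) \<le> 2" "card (nbrs E v2) \<le> 2" "card (nbrs E v3) \<le> 2"
    using v1 v2 v3 ne' v13 by auto
  have seen: "seen_colors E ?c ?h v1 a = {s1, p1}" "seen_colors E ?c ?h v1 v2 = {h a, p1}"
    "seen_colors E ?c ?h v2 v1 = {s2, p2}" "seen_colors E ?c ?h v2 v3 = {s1, p2}"
    "seen_colors E ?c ?h v3 v2 = {h b, p3}" "seen_colors E ?c ?h v3 b = {s2, p3}"
    by (auto simp add: seen_colors_def sets c h)
  have "full_coloring V E ?c ?h"
  proof (rule full_coloring_extend[OF D full])
    fix d y assume "d \<in> D" "y \<in> nbrs E d"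
    then consider "d = v1" "y = a" | "d = v1" "y = v2" | "d = v2" "y = v1" | "d = v2" "y = v3"
      | "d = v3" "y = v2" | "d = v3" "y = b" unfolding D_def using v1 v2 v3 by auto
    then show "seen_colors E ?c ?h d y \<inter>
        (if y \<in> D then seen_colors E ?c ?h y d else outer_colors E c h D y d) = {}"
      by cases (use s ab mem in \<open>simp_all add: seen\<close>)
  qed (use s in \<open>auto simp: i_def k_def\<close>)
  then show ?thesis by blast
qed

text \<open>The edges at \<open>v\<close> share one colour \<open>q\<close>, chosen against the
  three colours \<open>h (a x)\<close>. After that the threads are independent: \<open>s x\<close>
  for the edge \<open>{x, y x}\<close> and then \<open>p x\<close> for the virtual edge at
  \<open>x\<close> each avoid at most three colours.\<close>

lemma full_reduce_three_threads:
  fixes v :: 'a and y a :: "'a \<Rightarrow> 'a"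
  defines "X \<equiv> nbrs E v"
  defines "D \<equiv> insert v (X \<union> y ` X)"
  assumes D: "D \<subseteq> V" and full: "full_coloring (V - D) (induced E (V - D)) c h"
    and X: "card X = 3" and x: "\<And>x. x \<in> X \<Longrightarrow> nbrs E x = {v, y x}"
    and y: "\<And>x. x \<in> X \<Longrightarrow> nbrs E (y x) = {x, a x}" and a: "\<And>x. x \<in> X \<Longrightarrow> a x \<notin> D"
    and yX: "\<And>x. x \<in> X \<Longrightarrow> y x \<noteq> v \<and> y x \<notin> X" and inj: "inj_on y X"
  shows "\<exists>c h. full_coloring V E c h"
proof -
  have finX: "finite X" by (simp add: X_def)
  have vX: "v \<notin> X" by (simp add: X_def nbrs_irrefl)
  have "card ((\<lambda>x. h (a x)) ` X) \<le> 3" using X finX card_image_le by metis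
  then obtain q where q: "q \<in> {1..4}" "q \<notin> (\<lambda>x. h (a x)) ` X" using color_avoiding finX by blast
  have "\<exists>j\<in>{1..4}. j \<noteq> q \<and> j \<notin> outer_colors E c h D (a x) (y x)" if "x \<in> X" for x
  proof -
    have "y x \<in> nbrs E (a x)" using y[OF that] nbrs_sym[of "a x" E "y x"] by auto
    then have o: "finite (outer_colors E c h D (a x) (y x))" "card (outer_colors E c h D (a x) (y x)) \<le> 2"
      using outer_colors_card by blast+
    then have "card (insert q (outer_colors E c h D (a x) (y x))) \<le> 3"
      using card_insert_le_m1[of 3] by auto
    then show ?thesis using color_avoiding o(1) by (metis finite_insert insertCI)
  qed
  then obtain s where s: "\<And>x. x \<in> X \<Longrightarrow> s x \<in> {1..4}" "\<And>x. x \<in> X \<Longrightarrow> s x \<noteq> q"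
    "\<And>x. x \<in> X \<Longrightarrow> s x \<notin> outer_colors E c h D (a x) (y x)" by metis
  have "\<exists>j\<in>{1..4}. j \<notin> {q, h (a x), s x}" for x
  proof -
    have "card {q, h (a x), s x} \<le> 3" by (simp add: card_insert_if)
    then show ?thesis using color_avoiding by (metis finite.emptyI finite.insertI)
  qed
  then obtain p where p: "\<And>x. p x \<in> {1..4}" "\<And>x. p x \<notin> {q, h (a x), s x}" by metis
  \<comment> \<open>An edge within \<open>D\<close> that avoids \<open>v\<close> is some
    \<open>{x, y x}\<close>, whose only element in \<open>X\<close> is \<open>x\<close>.\<close>
  define i where "i = (\<lambda>e. if v \<in> e then q else s (the_elem (e \<inter> X)))"
  \<comment> \<open>The value at \<open>v\<close> is a default, since a 3-vertex has no virtual
    edge. The virtual edge at \<open>y x\<close> repeats the colour \<open>s x\<close>, so that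
    \<open>a x\<close> is shown one colour instead of two.\<close>
  define k where "k = (\<lambda>d. if d = v then 1 else if d \<in> X then p d else s (inv_into X y d))"
  let ?c = "extend_edges c h D i" and ?h = "extend_vertices h D k"
  have mem: "v \<in> D" "\<And>x. x \<in> X \<Longrightarrow> x \<in> D" "\<And>x. x \<in> X \<Longrightarrow> y x \<in> D" by (auto simp: D_def)
  have xv: "x \<noteq> v" if "x \<in> X" for x using that vX by auto
  have exy: "{x, y x} \<inter> X = {x}" if "x \<in> X" for x using that yX by auto
  have cc: "?c {v, x} = q" "?c {x, v} = q" "?c {x, y x} = s x" "?c {y x, x} = s x" "?c {y x, a x} = h (a x)"
    if "x \<in> X" for x
  proof -
    have "v \<notin> {x, y x}" using yX[OF that] xv[OF that] by auto
    then have "i {x, y x} = s x" using exy[OF that] by (simp add: i_def)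
    then show "?c {x, y x} = s x" using mem that by (simp add: extend_edges_inner)
    then show "?c {y x, x} = s x" by (simp add: insert_commute)
    show "?c {v, x} = q" "?c {x, v} = q" using mem that by (simp_all add: extend_edges_inner i_def)
    show "?c {y x, a x} = h (a x)" using mem(3)[OF that] a[OF that] by (simp add: extend_edges_outer)
  qed
  have hh: "?h x = p x" "?h (y x) = s x" if "x \<in> X" for x
    using that mem yX xv inj by (auto simp: extend_vertices_def k_def)
  have sets: "nbrs E x - {v} = {y x}" "nbrs E x - {y x} = {v}" "nbrs E (y x) - {x} = {a x}"
    "nbrs E (y x) - {a x} = {x}" "card (nbrs E x) \<le> 2" "card (nbrs E (y x)) \<le> 2" if "x \<in> X" for x
  proof -
    have "y x \<noteq> v" "a x \<noteq> x" using yX[OF that] a[OF that] mem(2)[OF that] by auto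
    then show "nbrs E x - {v} = {y x}" "nbrs E x - {y x} = {v}" "nbrs E (y x) - {x} = {a x}"
      "nbrs E (y x) - {a x} = {x}" "card (nbrs E x) \<le> 2" "card (nbrs E (y x)) \<le> 2"
      using x[OF that] y[OF that] by auto
  qed
  have seen: "seen_colors E ?c ?h x v = {s x, p x}" "seen_colors E ?c ?h x (y x) = {q, p x}"
    "seen_colors E ?c ?h (y x) x = {h (a x), s x}" "seen_colors E ?c ?h (y x) (a x) = {s x}"
    "seen_colors E ?c ?h v x \<subseteq> {q}"
    if "x \<in> X" for x
  proof -
    show "seen_colors E ?c ?h v x \<subseteq> {q}"
      using X cc(1) unfolding seen_colors_def X_def by auto
  qed (use that in \<open>auto simp add: seen_colors_def sets cc hh\<close>)
  have "full_coloring V E ?c ?h"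
  proof (rule full_coloring_extend[OF D full])
    fix d z assume dz: "d \<in> D" "z \<in> nbrs E d"
    then consider "d = v" | "d \<in> X" | x where "x \<in> X" "d = y x" by (auto simp: D_def)
    then consider x where "x \<in> X" "d = v" "z = x" | x where "x \<in> X" "d = x" "z = v"
      | x where "x \<in> X" "d = x" "z = y x" | x where "x \<in> X" "d = y x" "z = x"
      | x where "x \<in> X" "d = y x" "z = a x"
    proof cases
      case 1 then show ?thesis using that(1) dz by (auto simp: X_def)
    next
      case 2 then show ?thesis using that(2,3) dz x by auto
    next
      case 3 then show ?thesis using that(4,5) dz y by auto
    qed
    then show "seen_colors E ?c ?h d z \<inter>
        (if z \<in> D then seen_colors E ?c ?h z d else outer_colors E c h D z d) = {}"
    proof cases
      case 1
      then have "z \<in> D" "seen_colors E ?c ?h d z \<subseteq> {q}" "seen_colors E ?c ?h z d = {s x, p x}" "q \<noteq> s x" "q \<noteq> p x"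
        using mem seen[OF 1(1)] s(2)[OF 1(1)] p(2)[of x] by auto
      then show ?thesis by auto
    next
      case 2
      then have "z \<in> D" "seen_colors E ?c ?h z d \<subseteq> {q}" "seen_colors E ?c ?h d z = {s x, p x}" "q \<noteq> s x" "q \<noteq> p x"
        using mem seen[OF 2(1)] s(2)[OF 2(1)] p(2)[of x] by auto
      then show ?thesis by auto
    next
      case 3
      then have "q \<noteq> h (a x)" using q by auto
      then show ?thesis using 3 mem(3)[OF 3(1)] seen(2,3)[OF 3(1)] s(2)[OF 3(1)] p(2)[of x] by auto
    next
      case 4
      then have "q \<noteq> h (a x)" using q by auto
      then show ?thesis using 4 mem(2)[OF 4(1)] seen(2,3)[OF 4(1)] s(2)[OF 4(1)] p(2)[of x] by auto
    next
      case 5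
      then show ?thesis using a[OF 5(1)] seen(4)[OF 5(1)] s(3)[OF 5(1)] by auto
    qed
  next
    fix e assume e: "e \<in> E" "e \<subseteq> D"
    show "i e \<in> {1..4}"
    proof (cases "v \<in> e")
      case False
      obtain d z where dz: "e = {d, z}" using edgeE[OF e(1)] .
      have "\<exists>x\<in>X. e = {x, y x}"
      proof -
        have D1: "t \<in> X \<or> t \<in> y ` X" if "t \<in> e" for t using e False that by (auto simp: D_def)
        have zd: "z \<in> nbrs E d" "d \<in> nbrs E z" using e dz by (auto simp: nbrs_def insert_commute)
        consider "d \<in> X" | x where "x \<in> X" "d = y x" using D1[of d] dz by auto
        then show ?thesis
        proof cases
          case 1
          then have "z = y d" using x[OF 1] zd False dz by auto
          then show ?thesis using 1 dz by auto
        next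
          case (2 x)
          then have "z = x" using y[OF 2(1)] zd a[OF 2(1)] e(2) dz by auto
          then show ?thesis using 2 dz by auto
        qed
      qed
      then obtain x where x: "x \<in> X" "e = {x, y x}" by blast
      have "i e = s (the_elem (e \<inter> X))" using False by (simp add: i_def)
      then have "i e = s x" unfolding x(2) exy[OF x(1)] by simp
      then show ?thesis using s(1)[OF x(1)] by simp
    qed (use q in \<open>simp add: i_def\<close>)
  next
    fix d assume "d \<in> D"
    then consider "d = v" | "d \<in> X" | x where "x \<in> X" "d = y x" by (auto simp: D_def)
    then show "k d \<in> {1..4}"
    proof cases
      case 3
      then have "k d = s x" using yX[of x] inj by (simp add: k_def)
      then show ?thesis using s(1) 3 by simp
    qed (use p(1) in \<open>auto simp: k_def\<close>)
  qed
  then show ?thesis by blast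
qed

end

section \<open>Minimal counterexamples\<close>

context subcubic_graph
begin

lemma nbrs_two:
  assumes "card (nbrs E x) = 2" "y \<in> nbrs E x"
  obtains z where "nbrs E x = {y, z}" "y \<noteq> z"
proof -
  obtain s t where "nbrs E x = {s, t}" "s \<noteq> t" using assms(1) by (auto simp: card_2_iff)
  then show ?thesis using assms(2) that[of s] that[of t] by (auto simp: insert_commute)
qed

lemma no_triangle:
  assumes "\<forall>vs. is_cycle E vs \<longrightarrow> 6 \<le> length vs" "b \<in> nbrs E a" "c \<in> nbrs E b" "a \<in> nbrs E c"
  shows False
proof -
  have "is_cycle E [a, b, c]"
    using assms(2-) nbrs_irrefl[of a] nbrs_irrefl[of b] nbrs_irrefl[of c]
    by (auto simp: is_cycle_def less_Suc_eq nbrs_def)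
  then show False using assms(1) by fastforce
qed

lemma no_quadrilateral:
  assumes "\<forall>vs. is_cycle E vs \<longrightarrow> 6 \<le> length vs" "b \<in> nbrs E a" "c \<in> nbrs E b" "d \<in> nbrs E c" "a \<in> nbrs E d"
    "a \<noteq> c" "b \<noteq> d"
  shows False
proof -
  have "is_cycle E [a, b, c, d]"
    using assms(2-) nbrs_irrefl[of a] nbrs_irrefl[of b] nbrs_irrefl[of c] nbrs_irrefl[of d]
    by (auto simp: is_cycle_def less_Suc_eq nbrs_def)
  then show False using assms(1) by fastforce
qed

lemma no_pentagon:
  assumes "\<forall>vs. is_cycle E vs \<longrightarrow> 6 \<le> length vs" "b \<in> nbrs E a" "c \<in> nbrs E b" "d \<in> nbrs E c" "e \<in> nbrs E d"
    "a \<in> nbrs E e" "distinct [a, b, c, d, e]"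
  shows False
proof -
  have "is_cycle E [a, b, c, d, e]"
    using assms(2-) by (auto simp: is_cycle_def less_Suc_eq nbrs_def)
  then show False using assms(1) by fastforce
qed

lemma discharge_le: "discharge x \<le> 2"
  by (simp add: discharge_def)

lemma discharge_two:
  assumes "discharge x = 2" "v \<in> nbrs E x" "card (nbrs E v) \<noteq> 2"
  obtains y where "nbrs E x = {v, y}" "v \<noteq> y" "card (nbrs E y) = 2"
proof -
  have "card (nbrs E x) = 2" "\<exists>y\<in>nbrs E x. card (nbrs E y) = 2"
    using assms(1) by (auto simp: discharge_def split: if_splits)
  then show ?thesis using nbrs_two[OF _ assms(2)] assms(3) that by (metis insertE singletonD)
qed

lemma edges_empty: "V = {} \<Longrightarrow> E = {}"
  using edge_in edgeE by blast

lemma not_colorable_nonempty: "\<not> colorable k E E \<Longrightarrow> V \<noteq> {}"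
  using edges_empty by (auto simp: colorable_def)

lemma nbrs_subset_V: "y \<in> nbrs E x \<Longrightarrow> x \<in> V \<and> y \<in> V"
  using edge_in by (auto simp: nbrs_def)

end

text \<open>Since every 2-vertex is reducible, a minimal counterexample is cubic, and nothing is
  sent.\<close>

lemma sparse_graph_colorable_7:
  fixes V :: "'a set"
  assumes "sparse_graph 6 V E" shows "colorable 7 E E"
proof (rule ccontr)
  assume "\<not> ?thesis"
  from minimal_sparse_graph[OF assms, of "\<lambda>V E. colorable 7 E E", OF this]
  obtain V :: "'a set" and E where sp: "sparse_graph 6 V E" and nc: "\<not> colorable 7 E E"
    and red: "\<And>D. \<lbrakk>D \<subseteq> V; D \<noteq> {}\<rbrakk> \<Longrightarrow> colorable 7 (induced E (V - D)) (induced E (V - D))"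
    by blast
  interpret subcubic_graph V E using sp by unfold_locales (auto simp: sparse_graph_def)
  have no2: "card (nbrs E v) \<noteq> 2" for v
  proof
    assume v: "card (nbrs E v) = 2"
    then obtain x y where xy: "nbrs E v = {x, y}" by (auto simp: card_2_iff)
    then have "v \<in> V" using nbrs_subset_V[of x v] by auto
    then show False using reduce_two_vertex[OF _ xy] red[of "{v}"] nc by simp
  qed
  have "V \<noteq> {}" using not_colorable_nonempty[OF nc] .
  then show False
  proof (rule sparse_graph_reducible[OF sp, of 0])
    show "2 \<le> card (nbrs E v)" if "v \<in> V" for v
      using reduce_low_degree[of 7 v] red[of "{v}"] nc that by (cases "card (nbrs E v) \<le> 1") auto
    show "sum discharge (nbrs E v) \<le> 0" for v
      using no2 by (simp add: discharge_def)
  qed (use no2 in auto)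
qed

text \<open>In a minimal counterexample 2-vertices are pairwise nonadjacent and a 3-vertex has at
  most one 2-neighbour, so it sends at most 1.\<close>

lemma sparse_graph_colorable_6:
  fixes V :: "'a set"
  assumes "sparse_graph 8 V E" shows "colorable 6 E E"
proof (rule ccontr)
  assume "\<not> ?thesis"
  from minimal_sparse_graph[OF assms, of "\<lambda>V E. colorable 6 E E", OF this]
  obtain V :: "'a set" and E where sp: "sparse_graph 8 V E" and nc: "\<not> colorable 6 E E"
    and red: "\<And>D. \<lbrakk>D \<subseteq> V; D \<noteq> {}\<rbrakk> \<Longrightarrow> colorable 6 (induced E (V - D)) (induced E (V - D))"
    by blast
  interpret subcubic_graph V E using sp by unfold_locales (auto simp: sparse_graph_def)
  have no22: "card (nbrs E y) \<noteq> 2" if x: "card (nbrs E x) = 2" and y: "y \<in> nbrs E x" for x y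
  proof
    assume y2: "card (nbrs E y) = 2"
    obtain z where z: "nbrs E x = {y, z}" "y \<noteq> z" using nbrs_two[OF x y] .
    have "x \<in> nbrs E y" using y nbrs_sym by metis
    then obtain b where b: "nbrs E y = {x, b}" "x \<noteq> b" using nbrs_two[OF y2] by metis
    have z': "nbrs E x = {z, y}" "z \<noteq> y" using z by auto
    have "{x, y} \<subseteq> V" using nbrs_subset_V[OF y] by simp
    then show False using reduce_adjacent_two_vertices[OF _ z' b] red[of "{x, y}"] nc by simp
  qed
  have "V \<noteq> {}" using not_colorable_nonempty[OF nc] .
  then show False
  proof (rule sparse_graph_reducible[OF sp, of 1])
    show "2 \<le> card (nbrs E v)" if "v \<in> V" for v
      using reduce_low_degree[of 6 v] red[of "{v}"] nc that by (cases "card (nbrs E v) \<le> 1") auto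
    show "card (nbrs E z) \<noteq> 2" if "nbrs E x = {y, z}" "y \<noteq> z" "card (nbrs E y) = 2" for x y z
      using no22[of y x] no22[of x z] that nbrs_sym[of x E y] by auto
    fix v assume v: "card (nbrs E v) = 3"
    have d: "discharge x = (if card (nbrs E x) = 2 then 1 else 0)" for x
      using no22 by (auto simp: discharge_def)
    have "x = y" if xy: "x \<in> nbrs E v" "card (nbrs E x) = 2" "y \<in> nbrs E v" "card (nbrs E y) = 2" for x y
    proof (rule ccontr)
      assume ne: "x \<noteq> y"
      have "card (nbrs E v - {x} - {y}) = 1" using v xy ne by simp
      then obtain z where "nbrs E v - {x} - {y} = {z}" by (auto simp: card_1_singleton_iff)
      then have z: "nbrs E v = {x, y, z}" "x \<noteq> z" "y \<noteq> z" using xy by auto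
      have "v \<in> nbrs E x" "v \<in> nbrs E y" using xy nbrs_sym by metis+
      then obtain a b where a: "nbrs E x = {v, a}" "v \<noteq> a" and b: "nbrs E y = {v, b}" "v \<noteq> b"
        using nbrs_two xy by metis
      have "{x, v, y} \<subseteq> V" using nbrs_subset_V xy by blast
      then show False using reduce_two_two_neighbours[OF _ z(1) ne z(2,3) a b] red[of "{x, v, y}"] nc by simp
    qed
    then have "card {x \<in> nbrs E v. card (nbrs E x) = 2} \<le> 1"
      by (auto simp: card_le_Suc0_iff_eq)
    then show "sum discharge (nbrs E v) \<le> 1" by (simp add: d sum.If_cases Int_def)
  qed auto
qed

text \<open>Two ways of sending more than 2 are excluded: sending 2 to one neighbour while another
  has degree 2, and sending 1 to all three.\<close>

lemma sparse_graph_colorable_5: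
  fixes V :: "'a set"
  assumes "sparse_graph 10 V E" shows "colorable 5 E E"
proof (rule ccontr)
  assume "\<not> ?thesis"
  from minimal_sparse_graph[OF assms, of "\<lambda>V E. colorable 5 E E", OF this]
  obtain V :: "'a set" and E where sp: "sparse_graph 10 V E" and nc: "\<not> colorable 5 E E"
    and red: "\<And>D. \<lbrakk>D \<subseteq> V; D \<noteq> {}\<rbrakk> \<Longrightarrow> colorable 5 (induced E (V - D)) (induced E (V - D))"
    by blast
  interpret subcubic_graph V E using sp by unfold_locales (auto simp: sparse_graph_def)
  \<comment> \<open>The sum reaches 4 only if \<open>y\<close> has two further neighbours, both of
    degree 3. This also excludes three 2-vertices in a row.\<close>
  have large: "4 \<le> (\<Sum>z\<in>nbrs E y - {x}. card (nbrs E z) - 1)"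
    if x: "nbrs E x = {w, y}" "w \<noteq> y" "card (nbrs E w) = 2" for w x y
  proof (rule ccontr)
    assume s: "\<not> ?thesis"
    have "x \<in> nbrs E w" using x nbrs_sym[of w E x] by auto
    then obtain a where a: "nbrs E w = {x, a}" "x \<noteq> a" using nbrs_two[OF x(3)] by metis
    then have a': "nbrs E w = {a, x}" "a \<noteq> x" by auto
    have "{w, x} \<subseteq> V" using nbrs_subset_V[of w x] x by auto
    then show False using reduce_two_two_edge[OF _ a' x(1,2)] red[of "{w, x}"] nc s by simp
  qed
  have "V \<noteq> {}" using not_colorable_nonempty[OF nc] .
  then show False
  proof (rule sparse_graph_reducible[OF sp, of 2])
    show "2 \<le> card (nbrs E v)" if "v \<in> V" for v
      using reduce_low_degree[of 5 v] red[of "{v}"] nc that by (cases "card (nbrs E v) \<le> 1") auto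
    show "card (nbrs E z) \<noteq> 2" if x: "nbrs E x = {y, z}" "y \<noteq> z" "card (nbrs E y) = 2" for x y z
    proof
      assume z: "card (nbrs E z) = 2"
      have "x \<in> nbrs E z" using x nbrs_sym[of z E x] by auto
      then obtain b where b: "nbrs E z = {x, b}" "x \<noteq> b" using nbrs_two[OF z] by metis
      then have "nbrs E z - {x} = {b}" by auto
      then show False using large[OF x] card_nbrs_le[of b] by simp
    qed
    fix v assume v: "card (nbrs E v) = 3"
    have vx: "v \<in> nbrs E x" if "x \<in> nbrs E v" for x using that nbrs_sym by metis
    show "sum discharge (nbrs E v) \<le> 2"
    proof (cases "\<exists>x\<in>nbrs E v. discharge x = 2")
      case True
      then obtain x where x: "x \<in> nbrs E v" "discharge x = 2" by blast
      obtain y where y: "nbrs E x = {v, y}" "v \<noteq> y" "card (nbrs E y) = 2"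
        using discharge_two[OF x(2) vx[OF x(1)]] v by auto
      have "4 \<le> (\<Sum>z\<in>nbrs E v - {x}. card (nbrs E z) - 1)"
        using large[of x y v] y by (auto simp: insert_commute)
      moreover have "card (nbrs E v - {x}) = 2" using x v by simp
      then obtain s t where st: "nbrs E v - {x} = {s, t}" "s \<noteq> t" by (auto simp: card_2_iff)
      ultimately have "card (nbrs E s) = 3" "card (nbrs E t) = 3"
        using card_nbrs_le[of s] card_nbrs_le[of t] by auto
      then have "discharge s = 0" "discharge t = 0" by (auto simp: discharge_def)
      then show ?thesis using st sum.remove[OF finite_nbrs x(1), of discharge] x by simp
    next
      case False
      then have d: "discharge x \<le> 1" if "x \<in> nbrs E v" for x
        using discharge_le[of x] that by (metis One_nat_def Suc_1 le_SucE)
      obtain x y z where xyz: "nbrs E v = {x, y, z}" "distinct [x, y, z]"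
        using v by (auto simp: card_3_iff)
      have "\<not> (card (nbrs E x) = 2 \<and> card (nbrs E y) = 2 \<and> card (nbrs E z) = 2)"
      proof
        assume c: "card (nbrs E x) = 2 \<and> card (nbrs E y) = 2 \<and> card (nbrs E z) = 2"
        obtain a where a: "nbrs E x = {v, a}" "v \<noteq> a" using nbrs_two[of x v] vx[of x] c xyz by auto
        obtain b where b: "nbrs E y = {v, b}" "v \<noteq> b" using nbrs_two[of y v] vx[of y] c xyz by auto
        obtain e where e: "nbrs E z = {v, e}" "v \<noteq> e" using nbrs_two[of z v] vx[of z] c xyz by auto
        have "{v, x, y, z} \<subseteq> V" using nbrs_subset_V[of _ v] xyz by auto
        then show False
          using reduce_three_two_neighbours[OF _ xyz a b e] red[of "{v, x, y, z}"] nc by simp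
      qed
      then have "discharge x = 0 \<or> discharge y = 0 \<or> discharge z = 0" by (auto simp: discharge_def)
      moreover have "discharge x \<le> 1" "discharge y \<le> 1" "discharge z \<le> 1" using d xyz by auto
      ultimately show ?thesis using xyz by auto
    qed
  qed auto
qed

text \<open>A 3-vertex sends more than 5 only if it sends 2 to each neighbour, so that three threads
  start at it. The absence of cycles shorter than 6 makes the vertices of this configuration
  distinct and keeps the \<open>a x\<close> outside it.\<close>

lemma sparse_graph_colorable_4:
  fixes V :: "'a set"
  assumes "sparse_graph 16 V E" shows "colorable 4 E E"
proof (rule ccontr)
  assume "\<not> ?thesis"
  \<comment> \<open>The virtual colours belong to the inductive statement, so minimality is taken
    with respect to full colorings.\<close>
  then have "\<not> (\<exists>c h. full_coloring V E c h)" using colorable_if_full_coloring by blast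
  from minimal_sparse_graph[OF assms, of "\<lambda>V E. \<exists>c h. full_coloring V E c h", OF this]
  obtain V :: "'a set" and E where sp: "sparse_graph 16 V E" and nc: "\<not> (\<exists>c h. full_coloring V E c h)"
    and red: "\<And>D. \<lbrakk>D \<subseteq> V; D \<noteq> {}\<rbrakk> \<Longrightarrow> \<exists>c h. full_coloring (V - D) (induced E (V - D)) c h"
    by blast
  interpret subcubic_graph V E using sp by unfold_locales (auto simp: sparse_graph_def)
  have cyc: "\<forall>vs. is_cycle E vs \<longrightarrow> 6 \<le> length vs"
    using sp unfolding sparse_graph_def by fastforce
  note short = no_triangle[OF cyc] no_quadrilateral[OF cyc] no_pentagon[OF cyc]
  have "V \<noteq> {}"
  proof
    assume "V = {}"
    then have "E = {}" by (rule edges_empty)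
    then show False using nc \<open>V = {}\<close> by (auto simp: full_coloring_def nbrs_def)
  qed
  then show False
  proof (rule sparse_graph_reducible[OF sp, of 5])
    show "2 \<le> card (nbrs E v)" if v: "v \<in> V" for v
    proof (rule ccontr)
      assume "\<not> ?thesis"
      moreover obtain c h where "full_coloring (V - {v}) (induced E (V - {v})) c h"
        using red[of "{v}"] v by auto
      ultimately show False using full_reduce_low_degree[OF v] nc by fastforce
    qed
    show "card (nbrs E z) \<noteq> 2" if x: "nbrs E x = {y, z}" "y \<noteq> z" "card (nbrs E y) = 2" for x y z
    proof
      assume z: "card (nbrs E z) = 2"
      have xyz: "x \<in> nbrs E y" "x \<in> nbrs E z" "y \<in> nbrs E x" "z \<in> nbrs E x"
        using x nbrs_sym[of y E x] nbrs_sym[of z E x] by auto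
      obtain a where a: "nbrs E y = {x, a}" "x \<noteq> a" using nbrs_two[OF x(3) xyz(1)] .
      obtain b where b: "nbrs E z = {x, b}" "x \<noteq> b" using nbrs_two[OF z xyz(2)] .
      have "a \<noteq> y" "b \<noteq> z" using a b nbrs_irrefl[of y] nbrs_irrefl[of z] by auto
      moreover have "z \<notin> nbrs E y" using short(1)[of z y x] xyz by auto
      moreover from this have "y \<notin> nbrs E z" using nbrs_sym[of y E z] by auto
      ultimately have D: "a \<notin> {y, x, z}" "b \<notin> {y, x, z}" using a b by auto
      have sub: "{y, x, z} \<subseteq> V" using nbrs_subset_V xyz by blast
      then obtain c h where "full_coloring (V - {y, x, z}) (induced E (V - {y, x, z})) c h"
        using red[of "{y, x, z}"] by auto
      then show False
        using full_reduce_three_two_vertices[OF sub _ _ x(1) b(1) D x(2), of c h] a nc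
        by (auto simp: insert_commute)
    qed
    fix v assume v: "card (nbrs E v) = 3"
    show "sum discharge (nbrs E v) \<le> 5"
    proof (cases "\<exists>x\<in>nbrs E v. discharge x \<noteq> 2")
      case True
      then obtain x where x: "x \<in> nbrs E v" "discharge x \<noteq> 2" by blast
      then have "discharge x \<le> 1" using discharge_le[of x] by linarith
      moreover have "sum discharge (nbrs E v - {x}) \<le> 2 * 2"
        using sum_bounded_above[of "nbrs E v - {x}" discharge 2] discharge_le x v by simp
      ultimately show ?thesis using sum.remove[OF finite_nbrs x(1), of discharge] by simp
    next
      case False
      have vx: "v \<in> nbrs E x" if "x \<in> nbrs E v" for x using that nbrs_sym by metis
      have "\<exists>y a. nbrs E x = {v, y} \<and> v \<noteq> y \<and> nbrs E y = {x, a} \<and> x \<noteq> a" if x: "x \<in> nbrs E v" for x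
      proof -
        obtain y where y: "nbrs E x = {v, y}" "v \<noteq> y" "card (nbrs E y) = 2"
          using discharge_two[of x v] x vx[OF x] False v by auto
        moreover have "x \<in> nbrs E y" using y nbrs_sym[of y E x] by auto
        ultimately show ?thesis using nbrs_two[of y x] by metis
      qed
      then obtain y a where ya: "\<And>x. x \<in> nbrs E v \<Longrightarrow> nbrs E x = {v, y x}"
        "\<And>x. x \<in> nbrs E v \<Longrightarrow> v \<noteq> y x" "\<And>x. x \<in> nbrs E v \<Longrightarrow> nbrs E (y x) = {x, a x}"
        "\<And>x. x \<in> nbrs E v \<Longrightarrow> x \<noteq> a x" by metis
      have n: "y x \<in> nbrs E x" "x \<in> nbrs E (y x)" "a x \<in> nbrs E (y x)" if "x \<in> nbrs E v" for x
        using ya(1,3)[OF that] by auto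
      have yX: "y x \<noteq> v \<and> y x \<notin> nbrs E v" if "x \<in> nbrs E v" for x
        using short(1)[OF that n(1)[OF that]] vx[of "y x"] ya(2)[OF that] by auto
      have inj: "inj_on y (nbrs E v)"
      proof (rule inj_onI, rule ccontr)
        fix x x' assume x: "x \<in> nbrs E v" "x' \<in> nbrs E v" "y x = y x'" "x \<noteq> x'"
        then show False
          using short(2)[OF x(1) n(1)[OF x(1)] _ vx[OF x(2)] ya(2)[OF x(1)] x(4)] n(2)[OF x(2)] by simp
      qed
      let ?D = "insert v (nbrs E v \<union> y ` nbrs E v)"
      have aD: "a x \<notin> ?D" if x: "x \<in> nbrs E v" for x
      proof
        assume "a x \<in> ?D"
        then consider "a x = v" | "a x \<in> nbrs E v" | x' where "x' \<in> nbrs E v" "a x = y x'" by blast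
        then show False
        proof cases
          case 1
          then show ?thesis using short(1)[OF x n(1)[OF x]] n(3)[OF x] by simp
        next
          case 2
          then show ?thesis using short(2)[OF x n(1)[OF x] n(3)[OF x] vx[OF 2] ya(2,4)[OF x]] by simp
        next
          case (3 x')
          have "x \<noteq> x'" using 3 n(3)[OF x] nbrs_irrefl by metis
          moreover have "y x \<noteq> y x'" using 3 n(3)[OF x] nbrs_irrefl by metis
          moreover have "v \<noteq> x" "v \<noteq> x'" using x 3(1) nbrs_irrefl by metis+
          \<comment> \<open>If the middle edges of two threads were joined at \<open>y x\<close> and
            \<open>y x'\<close>, a pentagon through \<open>v\<close> would arise.\<close>
          ultimately have "distinct [v, x, y x, y x', x']" using x 3(1) yX[OF x] yX[OF 3(1)] by auto
          then show ?thesis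
            using short(3)[OF x n(1)[OF x] _ n(2)[OF 3(1)] vx[OF 3(1)]] n(3)[OF x] 3(2) by simp
        qed
      qed
      have sub: "?D \<subseteq> V"
      proof -
        have "nbrs E v \<noteq> {}" using v by auto
        then have "v \<in> V" using nbrs_subset_V by blast
        moreover have "y ` nbrs E v \<subseteq> V" using nbrs_subset_V[OF n(1)] by blast
        ultimately show ?thesis using nbrs_subset[of v] by blast
      qed
      obtain c h where full: "full_coloring (V - ?D) (induced E (V - ?D)) c h"
        using red[OF sub insert_not_empty] by blast
      have "\<exists>c h. full_coloring V E c h"
      proof (rule full_reduce_three_threads[OF sub full v])
        show "nbrs E x = {v, y x}" "nbrs E (y x) = {x, a x}" "a x \<notin> ?D" "y x \<noteq> v \<and> y x \<notin> nbrs E v"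
          if "x \<in> nbrs E v" for x
          using ya(1)[OF that] ya(3)[OF that] aD[OF that] yX[OF that] by simp_all
      qed (rule inj)
      then show ?thesis using nc by simp
    qed
  qed auto
qed

lemma planar_sparse_graph:
  assumes "simple_graph V E" "subcubic V E" "planar V E" "enat k \<le> girth E" "2 \<le> k"
  shows "sparse_graph k V E"
proof -
  have cyc: "k \<le> length vs" if "is_cycle E vs" for vs
  proof -
    have "girth E \<le> enat (length vs)" unfolding girth_def using that by (intro INF_lower) simp
    then have "enat k \<le> enat (length vs)" using assms(4) by (rule order_trans[rotated])
    then show ?thesis by simp
  qed
  have "(k - 2) * card (induced E S) < k * card S" if "S \<subseteq> V" "S \<noteq> {}" for S
    unfolding induced_def by (rule planar_density[OF assms(1,3) that assms(5)]) (rule cyc)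
  then show ?thesis using assms(1,2) cyc by (simp add: sparse_graph_def)
qed

lemma injective_chromatic_index_le:
  assumes "colorable k E E" shows "injective_chromatic_index E \<le> k"
  unfolding injective_chromatic_index_def
  by (intro Least_le injective_edge_coloring_if_colorable assms)

theorem corollary1p18:
  fixes V :: "'a set" and E :: "'a set set" and g :: enat
  assumes "simple_graph V E"
    and "subcubic V E"
    and "planar V E"
    and "girth E = g"
  shows "(g \<ge> 16 \<longrightarrow> injective_chromatic_index E \<le> 4) \<and>
         (g \<ge> 10 \<longrightarrow> injective_chromatic_index E \<le> 5) \<and>
         (g \<ge> 8 \<longrightarrow> injective_chromatic_index E \<le> 6) \<and>
         (g \<ge> 6 \<longrightarrow> injective_chromatic_index E \<le> 7)"
proof -
  have sparse: "sparse_graph (numeral k) V E" if "numeral k \<le> g" "2 \<le> (numeral k :: nat)" for k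
    using planar_sparse_graph[OF assms(1-3)] that assms(4) by (simp add: numeral_eq_enat)
  show ?thesis
    by (intro conjI impI injective_chromatic_index_le sparse_graph_colorable_4[of V]
        sparse_graph_colorable_5[of V] sparse_graph_colorable_6[of V] sparse_graph_colorable_7[of V] sparse)
      simp_all
qed

end
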